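(* Let $\mathcal{G}$ be a directed acyclic graph with vertex set $\boldsymbol{V}$, some of whose vertices are latent and the rest observable, with all observable variables discrete. Let $X,Y$ be observable vertices with the edge $X\rightarrow Y$ in $\mathcal{G}$, and let $\boldsymbol{C},\boldsymbol{D}$ be sets of observable vertices, with $\{X\},\{Y\},\boldsymbol{C},\boldsymbol{D}$ disjoint, such that no vertex in $\boldsymbol{C}$ is a descendant in $\mathcal{G}$ of a vertex in $\boldsymbol{D}$. Suppose further that, in the graph obtained from $\mathcal{G}$ by removing the edge $X\rightarrow Y$, $X$ is e-separated from $Y$ by $\boldsymbol{C}$ after deletion of $\boldsymbol{D}$. Consider any distribution in the model of $\mathcal{G}$, with $p$ denoting the resulting probabilities of the observable variables and $p(\cdot\mid\mathrm{do}(\cdot))$ the associated interventional probabilities. Let $$L(x,y,\boldsymbol{d}\mid\boldsymbol{c})=\max\left\{0,\ \frac{p(x,y,\boldsymbol{d}\mid\boldsymbol{c})}{p(x,\boldsymbol{d}\mid\boldsymbol{c})+1-p(\boldsymbol{d}\mid\boldsymbol{c})}\right\},$$ $$U(x,y,\boldsymbol{d}\mid\boldsymbol{c})=\min\left\{\frac{p(x,y,\boldsymbol{d}\mid\boldsymbol{c})+1-p(\boldsymbol{d}\mid\boldsymbol{c})}{p(x,\boldsymbol{d}\mid\boldsymbol{c})+1-p(\boldsymbol{d}\mid\boldsymbol{c})},\ 1\right\}.$$ Then, for all values $x,y,\boldsymbol{c},\boldsymbol{d}$ (for which the conditional probabilities and quotients involved are defined), $$L(x,y,\boldsymbol{d}\mid\boldsymbol{c})\le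 p(y\mid\mathrm{do}(x,\boldsymbol{d}),\boldsymbol{c})\le U(x,y,\boldsymbol{d}\mid\boldsymbol{c}),$$ and consequently, for binary $X$ and $Y$ (with values $0,1$; $x_i$ denotes $X=i$ and $y_i$ denotes $Y=i$), $$L(x_1,y_1,\boldsymbol{d}\mid\boldsymbol{c})-U(x_0,y_1,\boldsymbol{d}\mid\boldsymbol{c})\le \mathrm{ACDE}_{X\rightarrow Y}(\boldsymbol{d}\mid\boldsymbol{c})\le U(x_1,y_1,\boldsymbol{d}\mid\boldsymbol{c})-L(x_0,y_1,\boldsymbol{d}\mid\boldsymbol{c}).$$ If in addition $X$ is not a descendant in $\mathcal{G}$ of any vertex in $\boldsymbol{D}$, then all of these inequalities also hold with $L$ and $U$ replaced by $$L(x,y,\boldsymbol{d}\mid\boldsymbol{c})=p(y,\boldsymbol{d}\mid x,\boldsymbol{c}),\qquad U(x,y,\boldsymbol{d}\mid\boldsymbol{c})=p(y,\boldsymbol{d}\mid x,\boldsymbol{c})+1-p(\boldsymbol{d}\mid x,\boldsymbol{c}).$$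
   Context: Graphs and models. Each vertex of a directed acyclic graph (DAG) $\mathcal{G}$ is identified with a random variable, and a set of vertices with the corresponding random vector. $\mathrm{pa}_{\mathcal{G}}(V)$ is the set of parents of $V$. A vertex $Y$ is a descendant of $X$ (and $X$ an ancestor of $Y$) if there is a directed path from $X$ to $Y$. A joint distribution over $\boldsymbol{V}$ with density $f$ is in the model of $\mathcal{G}$ if $f$ factorizes as $\prod_{V\in\boldsymbol{V}} f(V\mid \mathrm{pa}_{\mathcal{G}}(V))$, a product of conditional densities (regarded as fixed conditional kernels). The vertices are partitioned into latent vertices $\boldsymbol{U}$ and observable vertices. The distribution of the observable variables is the margin $\int \prod_{V\in\boldsymbol{V}} f(V\mid\mathrm{pa}_{\mathcal{G}}(V))\,d\boldsymbol{U}$. The state spaces of the latent variables are arbitrary. Standing assumption: no latent vertex has any parents. d-separation. A path is a sequence of adjacent edges (of any orientation) without repeated vertices. An internal vertex of a path at which two arrowheads meet is a collider on the path; other internal vertices are non-colliders. A path is blocked given a vertex set $\boldsymbol{C}$ if it contains a non-collider in $\boldsymbol{C}$, or a collider that is neither in $\boldsymbol{C}$ nor an ancestor of a vertex in $\boldsymbol{C}$. Sets $\boldsymbol{A}$ and $\boldsymbol{B}$ are d-separated by $\boldsymbol{C}$ if every path from a vertex of $\boldsymbol{A}$ to a vertex of $\boldsymbol{B}$ is blocked given $\boldsymbol{C}$. e-separation. For $\boldsymbol{W}\subset\boldsymbol{V}$, $\mathcal{G}_{\boldsymbol{W}}$ is the induced subgraph on $\boldsymbol{W}$. For disjoint sets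 of observable vertices $\boldsymbol{A},\boldsymbol{B},\boldsymbol{C},\boldsymbol{D}$, $\boldsymbol{A}$ is e-separated from $\boldsymbol{B}$ by $\boldsymbol{C}$ after deletion of $\boldsymbol{D}$ in $\mathcal{G}$ if $\boldsymbol{A}$ and $\boldsymbol{B}$ are d-separated by $\boldsymbol{C}$ in $\mathcal{G}_{\boldsymbol{V}\setminus\boldsymbol{D}}$. Interventions. $\mathrm{do}(x)$ denotes the intervention fixing $X=x$: the density $f(\boldsymbol{V}\mid\mathrm{do}(x))$ is the joint density $\prod_{V} f(V\mid\mathrm{pa}_{\mathcal{G}}(V))$ with the factor $f(x\mid\mathrm{pa}_{\mathcal{G}}(X))$ removed (divided out) and multiplied by the indicator $\mathbf{1}_{\{X=x\}}$. Interventions on several variables, e.g. $\mathrm{do}(x,\boldsymbol{d})$, are defined by doing this for each of them. $p(y\mid\mathrm{do}(x,\boldsymbol{d}),\boldsymbol{c})$ is the conditional probability of $Y=y$ given $\boldsymbol{C}=\boldsymbol{c}$ under the interventional distribution (with latent variables integrated out). For binary $X,Y$, the average controlled direct effect is $$\mathrm{ACDE}_{X\rightarrow Y}(\boldsymbol{d}\mid\boldsymbol{c})=p(y_1\mid\mathrm{do}(x_1,\boldsymbol{d}),\boldsymbol{c})-p(y_1\mid\mathrm{do}(x_0,\boldsymbol{d}),\boldsymbol{c}).$$ Lower-case letters denote values of the corresponding variables, e.g. $p(x,y,\boldsymbol{d}\mid\boldsymbol{c})=P(X=x,Y=y,\boldsymbol{D}=\boldsymbol{d}\mid\boldsymbol{C}=\boldsymbol{c})$.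 "Discrete" means with a finite or countable state space. Conditional probabilities are considered only where the conditioning events have positive probability (under the relevant observational or interventional distribution), and quotients only where denominators are nonzero. *)

theory Defs
  imports "HOL-Probability.Probability"
begin

section \<open>Directed acyclic graphs, d-separation and e-separation\<close>

text \<open>A graph is given by its vertex set \<open>V\<close> and its set of directed edges \<open>E\<close>. There is a
  directed path from \<open>v\<close> to \<open>w\<close> iff \<open>(v, w) \<in> E\<^sup>+\<close>. Whether a vertex counts as its own
  descendant is immaterial below, because descent is only ever tested between distinct vertices.\<close>

definition finite_dag :: "'v set \<Rightarrow> ('v \<times> 'v) set \<Rightarrow> bool" where
  "finite_dag V E \<longleftrightarrow> finite V \<and> E \<subseteq> V \<times> V \<and> acyclic E"

definition parents :: "('v \<times> 'v) set \<Rightarrow> 'v \<Rightarrow> 'v set" where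
  "parents E v = {w. (w, v) \<in> E}"

definition descendant :: "('v \<times> 'v) set \<Rightarrow> 'v \<Rightarrow> 'v \<Rightarrow> bool" where
  "descendant E w v \<longleftrightarrow> (v, w) \<in> E\<^sup>+"

definition induced_edges :: "('v \<times> 'v) set \<Rightarrow> 'v set \<Rightarrow> ('v \<times> 'v) set" where
  "induced_edges E W = E \<inter> (W \<times> W)"

text \<open>In an acyclic graph at most one edge joins two given vertices, so a path is determined by
  the list of its vertices.\<close>

definition is_path :: "'v set \<Rightarrow> ('v \<times> 'v) set \<Rightarrow> 'v list \<Rightarrow> bool" where
  "is_path V E p \<longleftrightarrow> p \<noteq> [] \<and> set p \<subseteq> V \<and> distinct p \<and>
     (\<forall>i. Suc i < length p \<longrightarrow> (p ! i, p ! Suc i) \<in> E \<or> (p ! Suc i, p ! i) \<in> E)"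

definition internal :: "'v list \<Rightarrow> nat \<Rightarrow> bool" where
  "internal p i \<longleftrightarrow> 0 < i \<and> Suc i < length p"

definition collider :: "('v \<times> 'v) set \<Rightarrow> 'v list \<Rightarrow> nat \<Rightarrow> bool" where
  "collider E p i \<longleftrightarrow> internal p i \<and> (p ! (i - 1), p ! i) \<in> E \<and> (p ! Suc i, p ! i) \<in> E"

definition non_collider :: "('v \<times> 'v) set \<Rightarrow> 'v list \<Rightarrow> nat \<Rightarrow> bool" where
  "non_collider E p i \<longleftrightarrow> internal p i \<and> \<not> collider E p i"

definition blocked :: "('v \<times> 'v) set \<Rightarrow> 'v set \<Rightarrow> 'v list \<Rightarrow> bool" where
  "blocked E C p \<longleftrightarrow>
     (\<exists>i. non_collider E p i \<and> p ! i \<in> C) \<or>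
     (\<exists>i. collider E p i \<and> p ! i \<notin> C \<and> (\<forall>w\<in>C. \<not> descendant E w (p ! i)))"

definition d_separated ::
  "'v set \<Rightarrow> ('v \<times> 'v) set \<Rightarrow> 'v set \<Rightarrow> 'v set \<Rightarrow> 'v set \<Rightarrow> bool" where
  "d_separated V E A B C \<longleftrightarrow>
     (\<forall>p. is_path V E p \<and> hd p \<in> A \<and> last p \<in> B \<longrightarrow> blocked E C p)"

text \<open>\<open>A\<close> is e-separated from \<open>B\<close> by \<open>C\<close> after deletion of \<open>D\<close>.\<close>

definition e_separated ::
  "'v set \<Rightarrow> ('v \<times> 'v) set \<Rightarrow> 'v set \<Rightarrow> 'v set \<Rightarrow> 'v set \<Rightarrow> 'v set \<Rightarrow> bool" where
  "e_separated V E A B C D \<longleftrightarrow>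
     d_separated (V - D) (induced_edges E (V - D)) A B C"


section \<open>The model of a graph with latent vertices\<close>

text \<open>\<open>M v\<close> is the state space of the vertex \<open>v\<close> together with the reference measure for
  densities: the counting measure on a countable set if \<open>v\<close> is observable, and an arbitrary
  sigma-finite measure if \<open>v\<close> is in the latent set \<open>H\<close>. Any probability measure is allowed there
  (with density constantly 1), so the law of a parentless latent variable is unrestricted.\<close>

definition state_spaces :: "'v set \<Rightarrow> 'v set \<Rightarrow> ('v \<Rightarrow> 'a measure) \<Rightarrow> bool" where
  "state_spaces V H M \<longleftrightarrow>
     (\<forall>v\<in>V. sigma_finite_measure (M v)) \<and>
     (\<forall>v\<in>V - H. countable (space (M v)) \<and> M v = count_space (space (M v)))"

text \<open>\<open>f v w t\<close> is the conditional density of \<open>v\<close> at \<open>t\<close> given that its parents take the values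
  \<open>w\<close>; it is normalised for every \<open>w\<close>.\<close>

definition conditional_densities ::
  "'v set \<Rightarrow> ('v \<times> 'v) set \<Rightarrow> ('v \<Rightarrow> 'a measure) \<Rightarrow>
   ('v \<Rightarrow> ('v \<Rightarrow> 'a) \<Rightarrow> 'a \<Rightarrow> ennreal) \<Rightarrow> bool" where
  "conditional_densities V E M f \<longleftrightarrow>
     (\<forall>v\<in>V.
        (\<lambda>(w, t). f v w t) \<in> borel_measurable (PiM (parents E v) M \<Otimes>\<^sub>M M v) \<and>
        (\<forall>w\<in>space (PiM (parents E v) M). (\<integral>\<^sup>+t. f v w t \<partial>M v) = 1))"

definition model_factor ::
  "('v \<times> 'v) set \<Rightarrow> ('v \<Rightarrow> ('v \<Rightarrow> 'a) \<Rightarrow> 'a \<Rightarrow> ennreal) \<Rightarrow> 'v \<Rightarrow> ('v \<Rightarrow> 'a) \<Rightarrow> ennreal" where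
  "model_factor E f v \<omega> = f v (restrict \<omega> (parents E v)) (\<omega> v)"

definition joint_law ::
  "'v set \<Rightarrow> ('v \<times> 'v) set \<Rightarrow> ('v \<Rightarrow> 'a measure) \<Rightarrow>
   ('v \<Rightarrow> ('v \<Rightarrow> 'a) \<Rightarrow> 'a \<Rightarrow> ennreal) \<Rightarrow> ('v \<Rightarrow> 'a) measure" where
  "joint_law V E M f = density (PiM V M) (\<lambda>\<omega>. \<Prod>v\<in>V. model_factor E f v \<omega>)"

text \<open>The intervention that fixes every \<open>v \<in> I\<close> at the value \<open>a v\<close>. It is only used for sets \<open>I\<close>
  of observable vertices, whose reference measures are counting measures.\<close>

definition do_law ::
  "'v set \<Rightarrow> ('v \<times> 'v) set \<Rightarrow> ('v \<Rightarrow> 'a measure) \<Rightarrow>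
   ('v \<Rightarrow> ('v \<Rightarrow> 'a) \<Rightarrow> 'a \<Rightarrow> ennreal) \<Rightarrow> 'v set \<Rightarrow> ('v \<Rightarrow> 'a) \<Rightarrow> ('v \<Rightarrow> 'a) measure" where
  "do_law V E M f I a =
     density (PiM V M)
       (\<lambda>\<omega>. (\<Prod>v\<in>V - I. model_factor E f v \<omega>) * (\<Prod>v\<in>I. indicator {a v} (\<omega> v)))"

definition margin :: "('v \<Rightarrow> 'a measure) \<Rightarrow> 'v set \<Rightarrow> ('v \<Rightarrow> 'a) measure \<Rightarrow> ('v \<Rightarrow> 'a) measure" where
  "margin M W P = distr P (PiM W M) (\<lambda>\<omega>. restrict \<omega> W)"


section \<open>Interventional probabilities, controlled direct effect and bounds\<close>

text \<open>In what follows \<open>P\<close> is the law of the observable variables and \<open>Q I a\<close> their law under the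
  intervention fixing every \<open>v \<in> I\<close> at \<open>a v\<close>.\<close>

definition takes :: "('v \<Rightarrow> 'a) \<Rightarrow> 'v set \<Rightarrow> ('v \<Rightarrow> 'a) \<Rightarrow> bool" where
  "takes \<omega> W w \<longleftrightarrow> (\<forall>v\<in>W. \<omega> v = w v)"

text \<open>\<open>p(y | do(x, d), c)\<close>.\<close>

definition do_prob ::
  "('v set \<Rightarrow> ('v \<Rightarrow> 'a) \<Rightarrow> ('v \<Rightarrow> 'a) measure) \<Rightarrow> 'v \<Rightarrow> 'v \<Rightarrow> 'v set \<Rightarrow> 'v set \<Rightarrow>
   'a \<Rightarrow> 'a \<Rightarrow> ('v \<Rightarrow> 'a) \<Rightarrow> ('v \<Rightarrow> 'a) \<Rightarrow> real" where
  "do_prob Q X Y C D x y d c =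
     \<P>(\<omega> in Q (insert X D) (d(X := x)). \<omega> Y = y \<bar> takes \<omega> C c)"

text \<open>\<open>p(c) > 0\<close> under the intervention \<open>do(x, d)\<close>.\<close>

definition do_defined ::
  "('v set \<Rightarrow> ('v \<Rightarrow> 'a) \<Rightarrow> ('v \<Rightarrow> 'a) measure) \<Rightarrow> 'v \<Rightarrow> 'v set \<Rightarrow> 'v set \<Rightarrow>
   'a \<Rightarrow> ('v \<Rightarrow> 'a) \<Rightarrow> ('v \<Rightarrow> 'a) \<Rightarrow> bool" where
  "do_defined Q X C D x d c \<longleftrightarrow> \<P>(\<omega> in Q (insert X D) (d(X := x)). takes \<omega> C c) > 0"

definition ACDE ::
  "('v set \<Rightarrow> ('v \<Rightarrow> 'a) \<Rightarrow> ('v \<Rightarrow> 'a) measure) \<Rightarrow> 'v \<Rightarrow> 'v \<Rightarrow> 'v set \<Rightarrow> 'v set \<Rightarrow>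
   'a \<Rightarrow> 'a \<Rightarrow> 'a \<Rightarrow> ('v \<Rightarrow> 'a) \<Rightarrow> ('v \<Rightarrow> 'a) \<Rightarrow> real" where
  "ACDE Q X Y C D x\<^sub>0 x\<^sub>1 y\<^sub>1 d c =
     do_prob Q X Y C D x\<^sub>1 y\<^sub>1 d c - do_prob Q X Y C D x\<^sub>0 y\<^sub>1 d c"

text \<open>\<open>p(x, d | c) + 1 - p(d | c)\<close>.\<close>

definition bound_denom ::
  "('v \<Rightarrow> 'a) measure \<Rightarrow> 'v \<Rightarrow> 'v set \<Rightarrow> 'v set \<Rightarrow> 'a \<Rightarrow> ('v \<Rightarrow> 'a) \<Rightarrow> ('v \<Rightarrow> 'a) \<Rightarrow> real" where
  "bound_denom P X C D x d c =
     \<P>(\<omega> in P. \<omega> X = x \<and> takes \<omega> D d \<bar> takes \<omega> C c) + 1 - \<P>(\<omega> in P. takes \<omega> D d \<bar> takes \<omega> C c)"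

definition lower_bound ::
  "('v \<Rightarrow> 'a) measure \<Rightarrow> 'v \<Rightarrow> 'v \<Rightarrow> 'v set \<Rightarrow> 'v set \<Rightarrow>
   'a \<Rightarrow> 'a \<Rightarrow> ('v \<Rightarrow> 'a) \<Rightarrow> ('v \<Rightarrow> 'a) \<Rightarrow> real" where
  "lower_bound P X Y C D x y d c =
     max 0 (\<P>(\<omega> in P. \<omega> X = x \<and> \<omega> Y = y \<and> takes \<omega> D d \<bar> takes \<omega> C c) / bound_denom P X C D x d c)"

definition upper_bound ::
  "('v \<Rightarrow> 'a) measure \<Rightarrow> 'v \<Rightarrow> 'v \<Rightarrow> 'v set \<Rightarrow> 'v set \<Rightarrow>
   'a \<Rightarrow> 'a \<Rightarrow> ('v \<Rightarrow> 'a) \<Rightarrow> ('v \<Rightarrow> 'a) \<Rightarrow> real" where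
  "upper_bound P X Y C D x y d c =
     min ((\<P>(\<omega> in P. \<omega> X = x \<and> \<omega> Y = y \<and> takes \<omega> D d \<bar> takes \<omega> C c) + 1
             - \<P>(\<omega> in P. takes \<omega> D d \<bar> takes \<omega> C c)) / bound_denom P X C D x d c)
         1"

definition lower_bound' ::
  "('v \<Rightarrow> 'a) measure \<Rightarrow> 'v \<Rightarrow> 'v \<Rightarrow> 'v set \<Rightarrow> 'v set \<Rightarrow>
   'a \<Rightarrow> 'a \<Rightarrow> ('v \<Rightarrow> 'a) \<Rightarrow> ('v \<Rightarrow> 'a) \<Rightarrow> real" where
  "lower_bound' P X Y C D x y d c =
     \<P>(\<omega> in P. \<omega> Y = y \<and> takes \<omega> D d \<bar> \<omega> X = x \<and> takes \<omega> C c)"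

definition upper_bound' ::
  "('v \<Rightarrow> 'a) measure \<Rightarrow> 'v \<Rightarrow> 'v \<Rightarrow> 'v set \<Rightarrow> 'v set \<Rightarrow>
   'a \<Rightarrow> 'a \<Rightarrow> ('v \<Rightarrow> 'a) \<Rightarrow> ('v \<Rightarrow> 'a) \<Rightarrow> real" where
  "upper_bound' P X Y C D x y d c =
     \<P>(\<omega> in P. \<omega> Y = y \<and> takes \<omega> D d \<bar> \<omega> X = x \<and> takes \<omega> C c) + 1
       - \<P>(\<omega> in P. takes \<omega> D d \<bar> \<omega> X = x \<and> takes \<omega> C c)"

end

theory Submission
  imports Defs
begin

text \<open>Let \<open>p\<close> be the observational law, \<open>q\<close> the law under \<open>do(d)\<close> and \<open>r\<close> the law under
  \<open>do(x, d)\<close>. Densities of discrete variables are at most 1, so \<open>p(A, d) \<le> q(A)\<close> for every event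
  \<open>A\<close>; and \<open>q(c) = p(c)\<close> because \<open>C\<close> has no ancestor in \<open>D\<close>. Applied to \<open>A\<close> and to its
  complement this gives \<open>p(A, d | c) \<le> q(A | c) \<le> p(A, d | c) + 1 - p(d | c)\<close>.

  The e-separation yields \<open>r(y | c) = q(y | x, c)\<close>: in the moral graph of the ancestors of
  \<open>X\<close>, \<open>Y\<close> and \<open>C\<close> after deletion of \<open>D\<close> and of the edge \<open>X \<rightarrow> Y\<close>, the set \<open>C\<close> separates
  \<open>X\<close> from \<open>Y\<close>, so once \<open>x\<close>, \<open>c\<close>, \<open>d\<close> are fixed the density is a product of two functions of
  disjoint sets of variables, where the factor of \<open>X\<close> belongs to the first and \<open>Y\<close> to the second.
  Finally \<open>q(y | x, c)\<close> increases in \<open>q(x, y | c)\<close> and decreases in the probability that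
  \<open>X = x\<close> and \<open>Y \<noteq> y\<close>.\<close>

section \<open>Active walks and e-separation\<close>

definition anc :: "('v \<times> 'v) set \<Rightarrow> 'v set \<Rightarrow> 'v set" where
  "anc E T = {u. \<exists>t\<in>T. (u, t) \<in> E\<^sup>*}"

lemma anc_subset: "T \<subseteq> anc E T"
  by (auto simp: anc_def)

lemma anc_parent: "(u, v) \<in> E \<Longrightarrow> v \<in> anc E T \<Longrightarrow> u \<in> anc E T"
  by (auto simp: anc_def intro: converse_rtrancl_into_rtrancl)

lemma anc_subset_vertices: "E \<subseteq> V \<times> V \<Longrightarrow> T \<subseteq> V \<Longrightarrow> anc E T \<subseteq> V"
  by (auto simp: anc_def elim: converse_rtranclE)

text \<open>Whether a vertex blocks a walk depends only on it and its two neighbours. Testing all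
  windows of three by recursion lets walks be cut, joined and reversed without index
  arithmetic.\<close>

fun triples :: "('v \<Rightarrow> 'v \<Rightarrow> 'v \<Rightarrow> bool) \<Rightarrow> 'v list \<Rightarrow> bool" where
  "triples T (a # b # c # xs) \<longleftrightarrow> T a b c \<and> triples T (b # c # xs)"
| "triples T _ \<longleftrightarrow> True"

text \<open>Of all windows of three, only the one centred at \<open>w\<close> straddles the
  cut.\<close>

lemma triples_append:
  "triples T (xs @ w # ys) \<longleftrightarrow> triples T (xs @ [w]) \<and> triples T (w # ys) \<and>
     (xs \<noteq> [] \<longrightarrow> ys \<noteq> [] \<longrightarrow> T (last xs) w (hd ys))"
proof (induction xs rule: induct_list012)
  case (2 x)
  then show ?case by (cases ys) auto
next
  case (3 x y zs)
  then show ?case by (cases zs) auto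
qed simp

lemma triples_nth:
  "triples T p \<Longrightarrow> Suc (Suc i) < length p \<Longrightarrow> T (p ! i) (p ! Suc i) (p ! Suc (Suc i))"
proof (induction T p arbitrary: i rule: triples.induct)
  case (1 T a b c xs)
  then show ?case by (cases i) auto
qed auto

lemma triples_rev:
  assumes "\<And>a b c. T a b c \<Longrightarrow> T c b a"
  shows "triples T p \<Longrightarrow> triples T (rev p)"
proof (induction p rule: induct_list012)
  case (3 x y zs)
  then show ?case
    using assms triples_append[of T "rev zs" y "[x]"] by (cases zs) auto
qed auto

definition adjacent :: "('v \<times> 'v) set \<Rightarrow> 'v \<Rightarrow> 'v \<Rightarrow> bool" where
  "adjacent E a b \<longleftrightarrow> (a, b) \<in> E \<or> (b, a) \<in> E"

text \<open>The local form of not being blocked at \<open>b\<close>. Since \<open>anc\<close> is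
  reflexive, \<open>Z = anc E C\<close> covers both colliders in \<open>C\<close> and colliders that
  are proper ancestors of \<open>C\<close>.\<close>

definition passes :: "('v \<times> 'v) set \<Rightarrow> 'v set \<Rightarrow> 'v set \<Rightarrow> 'v \<Rightarrow> 'v \<Rightarrow> 'v \<Rightarrow> bool" where
  "passes E C Z a b c \<longleftrightarrow> (if (a, b) \<in> E \<and> (c, b) \<in> E then b \<in> Z else b \<notin> C)"

text \<open>Active walks may repeat vertices. Those with \<open>Z = anc E C\<close> generalise the unblocked paths;
  larger sets \<open>Z\<close> of admissible colliders occur on the way from moral connections to paths.\<close>

definition active :: "('v \<times> 'v) set \<Rightarrow> 'v set \<Rightarrow> 'v set \<Rightarrow> 'v list \<Rightarrow> bool" where
  "active E C Z p \<longleftrightarrow> p \<noteq> [] \<and> successively (adjacent E) p \<and> triples (passes E C Z) p"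

lemma active_append:
  "active E C Z (xs @ w # ys) \<longleftrightarrow> active E C Z (xs @ [w]) \<and> active E C Z (w # ys) \<and>
     (xs \<noteq> [] \<longrightarrow> ys \<noteq> [] \<longrightarrow> passes E C Z (last xs) w (hd ys))"
  unfolding active_def triples_append[of _ xs w ys]
  by (auto simp: successively_append_iff)

lemma active_snoc:
  "active E C Z (xs @ [v, u]) \<longleftrightarrow> active E C Z (xs @ [v]) \<and> adjacent E v u \<and>
     (xs \<noteq> [] \<longrightarrow> passes E C Z (last xs) v u)"
  using active_append[of E C Z xs v "[u]"] by (auto simp: active_def)

lemma active_rev: "active E C Z p \<Longrightarrow> active E C Z (rev p)"
  unfolding active_def
  by (auto simp: adjacent_def passes_def split: if_splits
      intro!: triples_rev[of "passes E C Z"] elim: successively_mono)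

lemma active_vertices:
  assumes "E \<subseteq> V \<times> V"
  shows "active E C Z p \<Longrightarrow> hd p \<in> V \<Longrightarrow> set p \<subseteq> V"
  using assms
proof (induction p rule: induct_list012)
  case (3 x y zs)
  then show ?case
    using active_append[of E C Z "[x]" y zs] by (auto simp: active_def adjacent_def)
qed auto

text \<open>A directed path that starts outside \<open>anc E C\<close> stays outside it, hence
  avoids \<open>C\<close>. By acyclicity no vertex on it is a collider, so the path is active
  whatever \<open>Z\<close> is.\<close>

lemma directed_active:
  assumes "(v, t) \<in> E\<^sup>*" "v \<notin> anc E C" "acyclic E"
  shows "\<exists>ys. active E C Z (v # ys) \<and> last (v # ys) = t \<and> (ys \<noteq> [] \<longrightarrow> (v, hd ys) \<in> E)"
  using assms(1,2)
proof (induction rule: converse_rtrancl_induct)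
  case base
  then show ?case by (intro exI[of _ "[]"]) (auto simp: active_def)
next
  case (step u v)
  then have v: "v \<notin> anc E C"
    using anc_parent by metis
  then obtain ys where ys: "active E C Z (v # ys)" "last (v # ys) = t" "ys \<noteq> [] \<longrightarrow> (v, hd ys) \<in> E"
    using step by auto
  have "v \<notin> C" using v anc_subset by fastforce
  moreover have "(hd ys, v) \<notin> E" if "ys \<noteq> []"
    using that ys(3) assms(3) by (meson acyclic_def trancl.simps)
  ultimately have "active E C Z ([u] @ v # ys)"
    unfolding active_append[of E C Z "[u]" v ys]
    using step ys by (auto simp: active_def adjacent_def passes_def)
  then show ?case using ys(2) step(1) by (intro exI[of _ "v # ys"]) auto
qed

text \<open>Walk along from the left and keep a prefix all of whose colliders are ancestors of \<open>C\<close>; a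
  collider that violates this is an ancestor of \<open>X\<close> or of \<open>Y\<close>, and a directed path from it to
  \<open>X\<close> (\<open>Y\<close>) replaces the walk before (after) it.\<close>

lemma reroute_colliders:
  assumes "acyclic E"
  shows "\<lbrakk>active E C (anc E C) (xs @ [v]); active E C (anc E ({X, Y} \<union> C)) (v # ys);
     xs \<noteq> [] \<longrightarrow> ys \<noteq> [] \<longrightarrow> passes E C (anc E ({X, Y} \<union> C)) (last xs) v (hd ys);
     hd (xs @ [v]) = X; last (v # ys) = Y\<rbrakk>
     \<Longrightarrow> \<exists>p. active E C (anc E C) p \<and> hd p = X \<and> last p = Y"
proof (induction ys arbitrary: xs v)
  case Nil
  then show ?case by (intro exI[of _ "xs @ [v]"]) auto
next
  case (Cons u ys)
  let ?S = "anc E ({X, Y} \<union> C)"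
  have vu: "adjacent E v u" and uys: "active E C ?S (u # ys)"
    and pass: "ys \<noteq> [] \<longrightarrow> passes E C ?S v u (hd ys)"
    using Cons.prems(2) active_append[of E C ?S "[v]" u ys] by (auto simp: active_def)
  \<comment> \<open>The prefix before \<open>v\<close> may be exchanged for any other active prefix
    \<open>xs'\<close> from \<open>X\<close>: the induction runs over the remaining walk, with the
    prefix arbitrary.\<close>
  have extend: ?case
    if "active E C (anc E C) (xs' @ [v])" "hd (xs' @ [v]) = X"
      "xs' \<noteq> [] \<longrightarrow> passes E C (anc E C) (last xs') v u" for xs'
  proof (rule Cons.IH[of "xs' @ [v]" u])
    show "active E C (anc E C) ((xs' @ [v]) @ [u])"
      using that vu active_snoc[of E C _ xs' v u] by auto
  qed (use that uys pass Cons.prems in \<open>auto simp: hd_append\<close>)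
  show ?case
  proof (cases "xs \<noteq> [] \<longrightarrow> passes E C (anc E C) (last xs) v u")
    case True
    then show ?thesis using extend[of xs] Cons.prems by auto
  next
    case False
    \<comment> \<open>The conditions for the two choices of \<open>Z\<close> differ only at
      colliders, so \<open>v\<close> is a collider that is an ancestor of \<open>X\<close> or
      \<open>Y\<close> but not of \<open>C\<close>.\<close>
    then have coll: "(last xs, v) \<in> E" "(u, v) \<in> E" "v \<in> ?S" "v \<notin> anc E C" "xs \<noteq> []"
      using Cons.prems(3) by (auto simp: passes_def split: if_splits)
    then have vC: "v \<notin> C" using anc_subset by fastforce
    from coll consider "(v, X) \<in> E\<^sup>*" | "(v, Y) \<in> E\<^sup>*" by (auto simp: anc_def)
    then show ?thesis
    proof cases
      \<comment> \<open>The directed path from \<open>v\<close> to \<open>X\<close> is traversed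
        backwards. It reaches \<open>v\<close> against an outgoing edge, so \<open>v\<close> turns
        into a non-collider outside \<open>C\<close>. If \<open>v = X\<close>, the walk simply
        restarts there.\<close>
      case 1
      then obtain zs where zs: "active E C (anc E C) (v # zs)" "last (v # zs) = X"
          "zs \<noteq> [] \<longrightarrow> (v, hd zs) \<in> E"
        using directed_active coll(4) assms by metis
      have "(hd zs, v) \<notin> E" if "zs \<noteq> []"
        using that zs(3) assms by (meson acyclic_def trancl.simps)
      then show ?thesis
        using extend[of "rev zs"] active_rev[OF zs(1)] zs vC
        by (auto simp: passes_def hd_append hd_rev last_rev split: if_splits)
    next
      \<comment> \<open>Continuing along the directed path from \<open>v\<close> to \<open>Y\<close>
        completes the walk, so the rest of the old walk is discarded.\<close>
      case 2
      then obtain zs where zs: "active E C (anc E C) (v # zs)" "last (v # zs) = Y"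
          "zs \<noteq> [] \<longrightarrow> (v, hd zs) \<in> E"
        using directed_active coll(4) assms by metis
      have "(hd zs, v) \<notin> E" if "zs \<noteq> []"
        using that zs(3) assms by (meson acyclic_def trancl.simps)
      then have "active E C (anc E C) (xs @ v # zs)"
        using zs Cons.prems(1) vC unfolding active_append[of E C _ xs v zs]
        by (auto simp: passes_def)
      then show ?thesis
        using zs(2) Cons.prems(4) coll(5) by (intro exI[of _ "xs @ v # zs"]) auto
    qed
  qed
qed

text \<open>The first edge points away from \<open>w\<close> and the last one points back towards
  it, so the orientation must switch somewhere. The first switch is a collider reached from
  \<open>w\<close> by a directed path; activity makes it an ancestor of \<open>C\<close>, and so
  \<open>w\<close> is one as well.\<close>

lemma active_out_out:
  "\<lbrakk>active E C (anc E C) (w # ys @ [w']); ys \<noteq> []; (w, hd ys) \<in> E; (w', last ys) \<in> E\<rbrakk>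
     \<Longrightarrow> w \<in> anc E C"
proof (induction ys arbitrary: w)
  case (Cons u ys)
  show ?case
  proof (cases ys)
    case Nil
    then have "u \<in> anc E C"
      using Cons.prems by (auto simp: active_def passes_def split: if_splits)
    then show ?thesis using Cons.prems anc_parent by fastforce
  next
    case (Cons u' ys')
    have *: "active E C (anc E C) (u # ys @ [w'])" "passes E C (anc E C) w u u'" "adjacent E u u'"
      using Cons.prems(1) Cons by (auto simp: active_def)
    have "u \<in> anc E C"
    proof (cases "(u', u) \<in> E")
      case True
      then show ?thesis using * Cons.prems by (auto simp: passes_def split: if_splits)
    next
      case False
      then show ?thesis
        using Cons.IH[of u] * Cons.prems Cons by (auto simp: adjacent_def)
    qed
    then show ?thesis using Cons.prems anc_parent by fastforce
  qed
qed simp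

text \<open>After the loop is cut out, only the condition at \<open>w\<close> is in question. If
  \<open>w\<close> is now a non-collider, it already was one at one of its two passages, so it is
  not in \<open>C\<close>. If \<open>w\<close> is now a collider outside \<open>anc E C\<close>,
  then both ends of the loop point away from \<open>w\<close>, which \<open>active_out_out\<close>
  excludes.\<close>

lemma active_shortcut:
  assumes "active E C (anc E C) (xs @ w # ys @ w # zs)" "acyclic E"
  shows "active E C (anc E C) (xs @ w # zs)"
proof -
  let ?Z = "anc E C"
  have 1: "active E C ?Z (xs @ [w])" "active E C ?Z (w # ys @ w # zs)"
    "xs \<noteq> [] \<longrightarrow> passes E C ?Z (last xs) w (hd (ys @ w # zs))"
    using assms(1) active_append[of E C ?Z xs w "ys @ w # zs"] by auto
  have 2: "active E C ?Z (w # ys @ [w])" "active E C ?Z (w # zs)"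
    "zs \<noteq> [] \<longrightarrow> passes E C ?Z (last (w # ys)) w (hd zs)"
    using 1(2) active_append[of E C ?Z "w # ys" w zs] by auto
  have anti: "(b, a) \<notin> E" if "(a, b) \<in> E" for a b
    using that assms(2) by (meson acyclic_def trancl.simps)
  have ys: "ys \<noteq> []"
    using 2(1) anti[of w w] by (auto simp: active_def adjacent_def)
  have a1: "adjacent E w (hd ys)" using 2(1) ys by (cases ys) (auto simp: active_def)
  have a2: "adjacent E (last ys) w"
    using 2(1) ys by (auto simp: active_def successively_append_iff successively_Cons)
  have "passes E C ?Z (last xs) w (hd zs)" if "xs \<noteq> []" "zs \<noteq> []"
  proof -
    have p: "passes E C ?Z (last xs) w (hd ys)" "passes E C ?Z (last ys) w (hd zs)"
      using 1 2 that ys by auto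
    have "w \<in> ?Z" if "(last xs, w) \<in> E" "(hd zs, w) \<in> E"
    proof (rule ccontr)
      assume "w \<notin> ?Z"
      then have "(w, hd ys) \<in> E" "(w, last ys) \<in> E"
        using p that a1 a2 by (auto simp: passes_def adjacent_def)
      then show False
        using active_out_out[OF 2(1) ys] \<open>w \<notin> ?Z\<close> by auto
    qed
    moreover have "w \<notin> C" if "(last xs, w) \<notin> E \<or> (hd zs, w) \<notin> E"
      using that p by (auto simp: passes_def split: if_splits)
    ultimately show ?thesis by (auto simp: passes_def)
  qed
  then show ?thesis
    using 1(1) 2(2) active_append[of E C ?Z xs w zs] by auto
qed

lemma active_imp_unblocked:
  assumes "active E C (anc E C) p"
  shows "\<not> blocked E C p"
proof
  have T: "passes E C (anc E C) (p ! (i - 1)) (p ! i) (p ! Suc i)" if "internal p i" for i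
    using triples_nth[of "passes E C (anc E C)" p "i - 1"] that assms
    by (auto simp: active_def internal_def)
  assume "blocked E C p"
  then show False unfolding blocked_def
  proof
    assume "\<exists>i. non_collider E p i \<and> p ! i \<in> C"
    then show False using T by (auto simp: non_collider_def collider_def passes_def)
  next
    assume "\<exists>i. collider E p i \<and> p ! i \<notin> C \<and> (\<forall>w\<in>C. \<not> descendant E w (p ! i))"
    then show False using T
      by (fastforce simp: collider_def passes_def anc_def descendant_def rtrancl_eq_or_trancl)
  qed
qed

text \<open>A shortest active walk has no repeated vertex.\<close>

lemma d_separated_imp_not_active:
  assumes sep: "d_separated V E {X} {Y} C" and "E \<subseteq> V \<times> V" "acyclic E" "X \<in> V"
  shows "\<not> (active E C (anc E ({X, Y} \<union> C)) p \<and> hd p = X \<and> last p = Y)"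
proof
  assume p: "active E C (anc E ({X, Y} \<union> C)) p \<and> hd p = X \<and> last p = Y"
  then obtain ys where "p = X # ys" by (cases p) (auto simp: active_def)
  then have "\<exists>p. active E C (anc E C) p \<and> hd p = X \<and> last p = Y"
    using reroute_colliders[of E C "[]" X X Y ys] p assms(3) by (auto simp: active_def)
  then obtain p' where "active E C (anc E C) p' \<and> hd p' = X \<and> last p' = Y" by blast
  then obtain q where q: "active E C (anc E C) q \<and> hd q = X \<and> last q = Y"
    and min: "\<And>r. active E C (anc E C) r \<and> hd r = X \<and> last r = Y \<Longrightarrow> length q \<le> length r"
    using ex_has_least_nat[of "\<lambda>p. active E C (anc E C) p \<and> hd p = X \<and> last p = Y" _ length]
    by blast
  have "distinct q"
  proof (rule ccontr)
    assume "\<not> distinct q"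
    then obtain xs w ys zs where eq: "q = xs @ w # ys @ w # zs"
      using not_distinct_decomp by fastforce
    then have "length q \<le> length (xs @ w # zs)"
      using active_shortcut[of E C xs w ys zs] q assms(3)
      by (intro min) (auto simp: hd_append last_append split: if_splits)
    then show False using eq by simp
  qed
  moreover have "set q \<subseteq> V" using active_vertices[OF assms(2)] q assms(4) by auto
  ultimately have "is_path V E q"
    using q by (auto simp: is_path_def active_def successively_conv_nth adjacent_def)
  then show False
    using sep q active_imp_unblocked by (auto simp: d_separated_def)
qed

text \<open>The set \<open>A\<close> consists of the vertices outside \<open>C\<close> that are connected to \<open>X\<close> in the moral
  graph (without the edge \<open>X \<rightarrow> Y\<close>) of the ancestors of \<open>X\<close>, \<open>Y\<close> and \<open>C\<close>; moral connections are
  active walks whose colliders are arbitrary ancestors of \<open>X\<close>, \<open>Y\<close> or \<open>C\<close>.\<close>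

lemma e_separated_split:
  assumes dag: "finite_dag V E"
    and XY: "X \<in> V" "Y \<in> V" "X \<noteq> Y" and CD: "C \<subseteq> V" "D \<subseteq> V" "C \<inter> D = {}"
    and notin: "X \<notin> C" "X \<notin> D" "Y \<notin> C" "Y \<notin> D"
    and sep: "e_separated V (E - {(X, Y)}) {X} {Y} C D"
  obtains A B F where
    "A \<subseteq> V" "B \<subseteq> V" "insert X (C \<union> D) \<inter> A = {}" "insert X (C \<union> D) \<inter> B = {}" "A \<inter> B = {}"
    "Y \<in> B" "X \<in> F" "F \<subseteq> insert X (C \<union> (A \<union> B))"
    "\<And>v. v \<in> F \<Longrightarrow> insert v (parents E v) \<subseteq> insert X (C \<union> D) \<union> A"
    "\<And>v. v \<in> insert X (C \<union> (A \<union> B)) - F \<Longrightarrow> insert v (parents E v) \<subseteq> insert X (C \<union> D) \<union> B"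
proof -
  define G where "G = induced_edges (E - {(X, Y)}) (V - D)"
  define S where "S = anc G ({X, Y} \<union> C)"
  define reach where "reach v \<longleftrightarrow> (\<exists>p. active G C S p \<and> hd p = X \<and> last p = v)" for v
  define R where "R = {v \<in> S - C. reach v}"
  \<comment> \<open>The factor of \<open>v\<close> involves \<open>v\<close> and its parents;
    \<open>F\<close> gathers the factors in \<open>S\<close> that involve some variable of
    \<open>R\<close>.\<close>
  define F where "F = {v \<in> S. insert v (parents G v) \<inter> R \<noteq> {}}"
  have GV: "G \<subseteq> (V - D) \<times> (V - D)" by (auto simp: G_def induced_edges_def)
  have GE: "(u, v) \<in> G" if "(u, v) \<in> E" "u \<notin> D" "v \<notin> D" "v \<noteq> Y \<or> u \<noteq> X" for u v
    using that dag by (auto simp: G_def induced_edges_def finite_dag_def)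
  have acG: "acyclic G"
    using dag by (auto simp: G_def induced_edges_def finite_dag_def intro: acyclic_subset)
  have SV: "S \<subseteq> V - D"
    unfolding S_def using GV XY CD notin by (intro anc_subset_vertices) auto
  have CS: "C \<subseteq> S" "X \<in> S" "Y \<in> S" using anc_subset[of "{X, Y} \<union> C" G] by (auto simp: S_def)
  have pS: "parents G v \<subseteq> S" if "v \<in> S" for v
    using that anc_parent[of _ v G] by (auto simp: S_def parents_def)
  \<comment> \<open>A vertex of \<open>R\<close> is in \<open>S\<close> and not in \<open>C\<close>,
    so a walk may pass it as a collider and as a non-collider alike.\<close>
  have step: "\<exists>p. active G C S (p @ [v, u]) \<and> hd (p @ [v, u]) = X"
    if v: "v \<in> R" "adjacent G v u" for v u
  proof -
    obtain q where q: "active G C S q" "hd q = X" "last q = v"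
      using v by (auto simp: R_def reach_def)
    define p where "p = butlast q"
    have p: "q = p @ [v]"
      using q append_butlast_last_id[of q] by (simp add: p_def active_def)
    then have "active G C S (p @ [v, u])"
      using q v by (auto simp: active_snoc passes_def R_def)
    then show ?thesis using q p by (intro exI[of _ p]) (auto simp: hd_append split: if_splits)
  qed
  have step1: "reach u" if vu: "v \<in> R" "adjacent G v u" for v u
  proof -
    obtain p where "active G C S (p @ [v, u])" "hd (p @ [v, u]) = X"
      using step[OF vu] by blast
    then show ?thesis unfolding reach_def by (intro exI[of _ "p @ [v, u]"]) simp
  qed
  \<comment> \<open>This is a moral edge: two parents of \<open>w\<close> are joined by a walk over
    \<open>w\<close>, an admissible collider because \<open>w\<close> is in
    \<open>S\<close>.\<close>
  have step2: "reach u" if "v \<in> R" "(v, w) \<in> G" "(u, w) \<in> G" "w \<in> S" for u v w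
  proof -
    obtain p where p: "active G C S (p @ [v, w])" "hd (p @ [v, w]) = X"
      using step[of v w] \<open>v \<in> R\<close> \<open>(v, w) \<in> G\<close> by (auto simp: adjacent_def)
    then have "active G C S ((p @ [v]) @ [w, u])"
      using that unfolding active_snoc[of G C S "p @ [v]"] by (auto simp: adjacent_def passes_def)
    then show ?thesis
      using p(2) unfolding reach_def
      by (intro exI[of _ "(p @ [v]) @ [w, u]"]) (auto simp: hd_append split: if_splits)
  qed
  have "reach X" unfolding reach_def by (intro exI[of _ "[X]"]) (auto simp: active_def)
  then have XR: "X \<in> R" using CS notin by (auto simp: R_def)
  have "d_separated (V - D) G {X} {Y} C"
    using sep by (simp add: e_separated_def G_def)
  then have "\<not> reach Y"
    using d_separated_imp_not_active[of "V - D" G X Y C] GV acG XY notin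
    unfolding reach_def S_def by blast
  then have YR: "Y \<notin> R" by (auto simp: R_def)
  \<comment> \<open>Any two members of a family are equal, adjacent, or parents of the same child.
    Once a family meets \<open>R\<close>, all its members are therefore reachable.\<close>
  have fam: "insert v (parents G v) \<subseteq> R \<union> C" if vF: "v \<in> F" for v
  proof
    fix w assume w: "w \<in> insert v (parents G v)"
    obtain u where u: "u \<in> R" "u \<in> insert v (parents G v)" and vS: "v \<in> S"
      using vF unfolding F_def by blast
    have "w \<in> S" using w vS pS by auto
    moreover have "reach w"
    proof -
      consider "w = u" | "adjacent G u w" | "(u, v) \<in> G" "(w, v) \<in> G"
        using w u(2) by (auto simp: parents_def adjacent_def)
      then show ?thesis
      proof cases
        case 1
        then show ?thesis using u(1) by (simp add: R_def)
      next
        case 2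
        then show ?thesis using step1 u(1) by blast
      next
        case 3
        then show ?thesis using step2 u(1) vS by blast
      qed
    qed
    ultimately show "w \<in> R \<union> C" by (auto simp: R_def)
  qed
  \<comment> \<open>The factor of \<open>Y\<close> thus falls on the other side, where its parent
    \<open>X\<close>, invisible in \<open>G\<close>, only occurs as a fixed value.\<close>
  have YF: "Y \<notin> F" using fam[of Y] YR notin by auto
  \<comment> \<open>Passing from \<open>E\<close> to \<open>G\<close> loses only parents in
    \<open>D\<close> and the parent \<open>X\<close> of \<open>Y\<close>; all of these belong to the
    fixed set.\<close>
  have pE: "parents E v \<subseteq> parents G v \<union> D \<union> (if v = Y then {X} else {})" if "v \<in> S" for v
    using that SV GE by (auto simp: parents_def)
  show thesis
  \<comment> \<open>\<open>X\<close> itself is removed from \<open>R\<close>, since it is one of the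
    fixed vertices \<open>insert X (C \<union> D)\<close>.\<close>
  proof (rule that[of "R - {X}" "S - R - C" F])
    show "Y \<in> S - R - C" using CS YR notin by auto
    show "X \<in> F" using XR CS by (auto simp: F_def)
    show "F \<subseteq> insert X (C \<union> (R - {X} \<union> (S - R - C)))" by (auto simp: F_def)
    show "insert v (parents E v) \<subseteq> insert X (C \<union> D) \<union> (R - {X})" if "v \<in> F" for v
    proof -
      have "v \<in> S" "v \<noteq> Y" using that YF by (auto simp: F_def)
      then have "insert v (parents E v) \<subseteq> insert v (parents G v) \<union> D" using pE[of v] by auto
      then show ?thesis using fam[OF that] by blast
    qed
    show "insert v (parents E v) \<subseteq> insert X (C \<union> D) \<union> (S - R - C)"
      if "v \<in> insert X (C \<union> (R - {X} \<union> (S - R - C))) - F" for v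
    proof -
      have vS: "v \<in> S" using that CS by (auto simp: R_def)
      then have "insert v (parents G v) \<inter> R = {}" using that by (auto simp: F_def)
      moreover have "insert v (parents E v) \<subseteq> insert v (parents G v) \<union> insert X D"
        using pE[OF vS] by (auto split: if_splits)
      ultimately show ?thesis using pS[OF vS] vS by blast
    qed
  qed (use SV XR in \<open>auto simp: R_def\<close>)
qed

section \<open>Marginal and interventional laws\<close>

text \<open>The indicators confine the coordinates in \<open>K\<close> to a single point of mass 1.
  What remains is an integral over \<open>A\<close> and \<open>B\<close>, where the integrand is a
  product of functions of separate variables, so it factors by Fubini.\<close>

lemma (in product_sigma_finite) nn_integral_fixed_split:
  assumes fin: "finite K" "finite A" "finite B"
    and disj: "K \<inter> A = {}" "K \<inter> B = {}" "A \<inter> B = {}"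
    and k: "\<And>v. v \<in> K \<Longrightarrow> {k v} \<in> sets (M v)" "\<And>v. v \<in> K \<Longrightarrow> emeasure (M v) {k v} = 1"
    and h1[measurable]: "h1 \<in> borel_measurable (PiM (K \<union> A) M)"
    and h2[measurable]: "h2 \<in> borel_measurable (PiM (K \<union> B) M)"
  shows "(\<integral>\<^sup>+\<omega>. h1 (restrict \<omega> (K \<union> A)) * h2 (restrict \<omega> (K \<union> B)) * (\<Prod>v\<in>K. indicator {k v} (\<omega> v))
             \<partial>PiM (K \<union> (A \<union> B)) M)
         = (\<integral>\<^sup>+z. h1 (merge K A (restrict k K, z)) \<partial>PiM A M) *
           (\<integral>\<^sup>+z. h2 (merge K B (restrict k K, z)) \<partial>PiM B M)"
proof -
  let ?k = "restrict k K"
  have kspace: "?k \<in> space (PiM K M)"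
    using k(1) sets.sets_into_space by (fastforce simp: space_PiM)
  have single: "{?k} = PiE K (\<lambda>v. {k v})"
    by (auto simp: PiE_def extensional_def fun_eq_iff)
  have ksets: "{?k} \<in> sets (PiM K M)"
    unfolding single using k(1) fin by (intro sets_PiM_I_finite) auto
  have kone: "emeasure (PiM K M) {?k} = 1"
    unfolding single using k fin by (subst emeasure_PiM) auto
  have [measurable]: "(\<lambda>\<omega>. restrict \<omega> (K \<union> A)) \<in> measurable (PiM (K \<union> (A \<union> B)) M) (PiM (K \<union> A) M)"
    "(\<lambda>\<omega>. restrict \<omega> (K \<union> B)) \<in> measurable (PiM (K \<union> (A \<union> B)) M) (PiM (K \<union> B) M)"
    by (auto intro!: measurable_restrict_subset)
  have [measurable]: "(\<lambda>\<omega>. \<Prod>v\<in>K. indicator {k v} (\<omega> v) :: ennreal) \<in> borel_measurable (PiM (K \<union> (A \<union> B)) M)"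
  proof (rule borel_measurable_prod_ennreal)
    fix v assume v: "v \<in> K"
    then have [measurable]: "{k v} \<in> sets (M v)" using k by auto
    from v have [measurable]: "(\<lambda>\<omega>. \<omega> v) \<in> measurable (PiM (K \<union> (A \<union> B)) M) (M v)"
      by (intro measurable_component_singleton) auto
    show "(\<lambda>\<omega>. indicator {k v} (\<omega> v) :: ennreal) \<in> borel_measurable (PiM (K \<union> (A \<union> B)) M)"
      by measurable
  qed
  have [measurable]: "(\<lambda>z. merge K A (?k, z)) \<in> measurable (PiM A M) (PiM (K \<union> A) M)"
    "(\<lambda>z. merge K B (?k, z)) \<in> measurable (PiM B M) (PiM (K \<union> B) M)"
    by (rule measurable_compose[OF measurable_Pair[OF measurable_const[OF kspace] measurable_ident_sets[OF refl]] measurable_merge])+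
  have [measurable]: "(\<lambda>z. merge K (A \<union> B) (?k, z)) \<in> measurable (PiM (A \<union> B) M) (PiM (K \<union> (A \<union> B)) M)"
    by (rule measurable_compose[OF measurable_Pair[OF measurable_const[OF kspace] measurable_ident_sets[OF refl]] measurable_merge])+
  let ?G = "\<lambda>\<omega>. h1 (restrict \<omega> (K \<union> A)) * h2 (restrict \<omega> (K \<union> B))"
  let ?I = "\<lambda>\<omega>. \<Prod>v\<in>K. indicator {k v} (\<omega> v) :: ennreal"
  have "(\<integral>\<^sup>+\<omega>. ?G \<omega> * ?I \<omega> \<partial>PiM (K \<union> (A \<union> B)) M) =
      (\<integral>\<^sup>+\<kappa>. (\<integral>\<^sup>+z. ?G (merge K (A \<union> B) (\<kappa>, z)) * ?I (merge K (A \<union> B) (\<kappa>, z)) \<partial>PiM (A \<union> B) M) \<partial>PiM K M)"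
    using fin disj by (subst product_nn_integral_fold) auto
  also have "\<dots> = (\<integral>\<^sup>+\<kappa>. (\<integral>\<^sup>+z. ?G (merge K (A \<union> B) (?k, z)) \<partial>PiM (A \<union> B) M) * indicator {?k} \<kappa> \<partial>PiM K M)"
  proof (rule nn_integral_cong)
    fix \<kappa> assume \<kappa>: "\<kappa> \<in> space (PiM K M)"
    \<comment> \<open>A single coordinate that differs from \<open>k\<close> makes the whole product
      of indicators vanish.\<close>
    have ind: "?I (merge K (A \<union> B) (\<kappa>, z)) = indicator {?k} \<kappa>" for z
    proof (cases "\<kappa> = ?k")
      case True
      then show ?thesis by (auto intro!: prod.neutral simp: merge_def)
    next
      case False
      then obtain v where v: "v \<in> K" "\<kappa> v \<noteq> k v"
        using \<kappa> by (auto simp: space_PiM PiE_def extensional_def fun_eq_iff split: if_splits)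
      have "?I (merge K (A \<union> B) (\<kappa>, z)) = 0"
        using fin v by (intro prod_zero) (auto simp: merge_def intro!: bexI[of _ v])
      then show ?thesis using False by simp
    qed
    show "(\<integral>\<^sup>+z. ?G (merge K (A \<union> B) (\<kappa>, z)) * ?I (merge K (A \<union> B) (\<kappa>, z)) \<partial>PiM (A \<union> B) M)
        = (\<integral>\<^sup>+z. ?G (merge K (A \<union> B) (?k, z)) \<partial>PiM (A \<union> B) M) * indicator {?k} \<kappa>"
      unfolding ind by (cases "\<kappa> = ?k") auto
  qed
  also have "\<dots> = (\<integral>\<^sup>+z. ?G (merge K (A \<union> B) (?k, z)) \<partial>PiM (A \<union> B) M)"
    using ksets kone by simp
  also have "\<dots> = (\<integral>\<^sup>+a. (\<integral>\<^sup>+b. ?G (merge K (A \<union> B) (?k, merge A B (a, b))) \<partial>PiM B M) \<partial>PiM A M)"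
  proof (rule product_nn_integral_fold)
    show "(\<lambda>z. ?G (merge K (A \<union> B) (?k, z))) \<in> borel_measurable (PiM (A \<union> B) M)"
      by measurable
  qed (use fin disj in auto)
  also have "\<dots> = (\<integral>\<^sup>+a. (\<integral>\<^sup>+b. h1 (merge K A (?k, a)) * h2 (merge K B (?k, b)) \<partial>PiM B M) \<partial>PiM A M)"
  proof -
    have 1: "restrict (merge K (A \<union> B) (?k, merge A B (a, b))) (K \<union> A) = merge K A (?k, a)" for a b
      by (auto simp: merge_def fun_eq_iff)
    have 2: "restrict (merge K (A \<union> B) (?k, merge A B (a, b))) (K \<union> B) = merge K B (?k, b)" for a b
      using disj by (auto simp: merge_def fun_eq_iff)
    show ?thesis unfolding 1 2 ..
  qed
  also have "\<dots> = (\<integral>\<^sup>+a. h1 (merge K A (?k, a)) \<partial>PiM A M) * (\<integral>\<^sup>+b. h2 (merge K B (?k, b)) \<partial>PiM B M)"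
  proof -
    have m: "(\<lambda>a. h1 (merge K A (?k, a))) \<in> borel_measurable (PiM A M)"
      "(\<lambda>b. h2 (merge K B (?k, b))) \<in> borel_measurable (PiM B M)"
      by measurable
    show ?thesis
      unfolding nn_integral_cmult[OF m(2)] nn_integral_multc[OF m(1)] ..
  qed
  finally show ?thesis .
qed

section \<open>Margins of a DAG model over ancestral sets\<close>

locale dag_model = product_sigma_finite M for M :: "'v \<Rightarrow> 'a measure" +
  fixes V :: "'v set" and E :: "('v \<times> 'v) set"
    and f :: "'v \<Rightarrow> ('v \<Rightarrow> 'a) \<Rightarrow> 'a \<Rightarrow> ennreal"
  assumes dag: "finite_dag V E" and densities: "conditional_densities V E M f"
begin

lemma finite_vertices: "finite V"
  using dag by (simp add: finite_dag_def)

lemma parents_subset_vertices: "parents E v \<subseteq> V"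
  using dag by (auto simp: finite_dag_def parents_def)

lemma borel_measurable_model_factor:
  assumes "v \<in> V" "v \<in> T" "parents E v \<subseteq> T"
  shows "model_factor E f v \<in> borel_measurable (PiM T M)"
proof -
  have "(\<lambda>\<omega>. (restrict \<omega> (parents E v), \<omega> v)) \<in> measurable (PiM T M) (PiM (parents E v) M \<Otimes>\<^sub>M M v)"
    using assms by (intro measurable_Pair measurable_restrict_subset measurable_component_singleton)
  moreover have "(\<lambda>(w, t). f v w t) \<in> borel_measurable (PiM (parents E v) M \<Otimes>\<^sub>M M v)"
    using densities assms(1) by (auto simp: conditional_densities_def)
  ultimately show ?thesis
    unfolding model_factor_def[abs_def] by (auto dest: measurable_compose)
qed

lemma borel_measurable_prod_model_factor:
  assumes "S \<subseteq> V" "S \<subseteq> T" "\<And>v. v \<in> S \<Longrightarrow> parents E v \<subseteq> T"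
  shows "(\<lambda>\<omega>. \<Prod>v\<in>S. model_factor E f v \<omega>) \<in> borel_measurable (PiM T M)"
  using assms by (intro borel_measurable_prod_ennreal borel_measurable_model_factor) auto

lemma sets_joint_law [measurable_cong]: "sets (joint_law S E M f) = sets (PiM S M)"
  by (simp add: joint_law_def)

lemma space_joint_law: "space (joint_law S E M f) = space (PiM S M)"
  by (simp add: joint_law_def)

text \<open>Since \<open>S\<close> is closed under parents, \<open>v\<close> is a parent of no
  vertex in \<open>S\<close>. Only its own factor depends on it, and that factor integrates to
  1.\<close>

lemma margin_joint_law_insert:
  assumes S: "S \<subseteq> V" "\<And>u. u \<in> S \<Longrightarrow> parents E u \<subseteq> S" and v: "v \<in> V" "v \<notin> S" "parents E v \<subseteq> S"
  shows "margin M S (joint_law (insert v S) E M f) = joint_law S E M f"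
proof (rule measure_eqI)
  fix A assume "A \<in> sets (margin M S (joint_law (insert v S) E M f))"
  then have A[measurable]: "A \<in> sets (PiM S M)" by (simp add: margin_def)
  have finS: "finite S" using S(1) finite_vertices finite_subset by auto
  have r[measurable]: "(\<lambda>\<omega>. restrict \<omega> S) \<in> measurable (PiM (insert v S) M) (PiM S M)"
    by (rule measurable_restrict_subset) auto
  have [measurable]: "(\<lambda>\<omega>. \<Prod>u\<in>insert v S. model_factor E f u \<omega>) \<in> borel_measurable (PiM (insert v S) M)"
    "(\<lambda>\<omega>. \<Prod>u\<in>S. model_factor E f u \<omega>) \<in> borel_measurable (PiM S M)"
    using S v by (auto intro!: borel_measurable_prod_model_factor)
  have fv: "(\<lambda>(w, t). f v w t) \<in> borel_measurable (PiM (parents E v) M \<Otimes>\<^sub>M M v)"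
    "\<And>w. w \<in> space (PiM (parents E v) M) \<Longrightarrow> (\<integral>\<^sup>+t. f v w t \<partial>M v) = 1"
    using densities v by (auto simp: conditional_densities_def)
  have "emeasure (margin M S (joint_law (insert v S) E M f)) A =
      (\<integral>\<^sup>+\<omega>. (\<Prod>u\<in>insert v S. model_factor E f u \<omega>) * indicator A (restrict \<omega> S) \<partial>PiM (insert v S) M)"
    unfolding margin_def joint_law_def
    by (subst emeasure_distr)
       (auto simp: emeasure_density intro!: nn_integral_cong split: split_indicator)
  also have "\<dots> = (\<integral>\<^sup>+z. (\<integral>\<^sup>+t. (\<Prod>u\<in>insert v S. model_factor E f u (z(v := t))) *
      indicator A (restrict (z(v := t)) S) \<partial>M v) \<partial>PiM S M)"
  proof (rule product_nn_integral_insert[OF finS v(2)])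
    show "(\<lambda>z. (\<Prod>u\<in>insert v S. model_factor E f u z) * indicator A (restrict z S))
        \<in> borel_measurable (PiM (insert v S) M)"
      by measurable
  qed
  also have "\<dots> = (\<integral>\<^sup>+z. (\<Prod>u\<in>S. model_factor E f u z) * indicator A z \<partial>PiM S M)"
  proof (rule nn_integral_cong)
    fix z assume z: "z \<in> space (PiM S M)"
    have w: "restrict z (parents E v) \<in> space (PiM (parents E v) M)"
      using z v(3) by (auto simp: space_PiM)
    have 1: "restrict (z(v := t)) S = z" for t
      using z v(2) by (auto simp: space_PiM PiE_def extensional_def fun_eq_iff)
    have 2: "model_factor E f u (z(v := t)) = model_factor E f u z" if "u \<in> S" for u t
    proof -
      have "restrict (z(v := t)) (parents E u) = restrict z (parents E u)"
        using S(2)[OF that] v(2) by (auto simp: fun_eq_iff)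
      then show ?thesis using that v(2) by (auto simp: model_factor_def)
    qed
    have 3: "model_factor E f v (z(v := t)) = f v (restrict z (parents E v)) t" for t
    proof -
      have "restrict (z(v := t)) (parents E v) = restrict z (parents E v)"
        using v by (auto simp: fun_eq_iff)
      then show ?thesis by (simp add: model_factor_def)
    qed
    have meas: "(\<lambda>t. f v (restrict z (parents E v)) t) \<in> borel_measurable (M v)"
      using measurable_compose[OF measurable_Pair1'[OF w] fv(1)] by simp
    show "(\<integral>\<^sup>+t. (\<Prod>u\<in>insert v S. model_factor E f u (z(v := t))) *
        indicator A (restrict (z(v := t)) S) \<partial>M v) = (\<Prod>u\<in>S. model_factor E f u z) * indicator A z"
      using finS v(2) fv(2)[OF w] meas
      by (simp add: 1 2 3 nn_integral_cmult nn_integral_multc)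
  qed
  also have "\<dots> = emeasure (joint_law S E M f) A"
    unfolding joint_law_def by (simp add: emeasure_density)
  finally show "emeasure (margin M S (joint_law (insert v S) E M f)) A = emeasure (joint_law S E M f) A" .
qed (simp add: margin_def joint_law_def)

text \<open>The vertices outside \<open>S\<close> are integrated out one at a time. A minimal vertex
  outside \<open>S\<close> has all its parents in \<open>S\<close>, so adding it keeps the set
  closed under parents, and the induction applies to the larger set.\<close>

lemma margin_joint_law:
  assumes "S \<subseteq> V" "\<And>u. u \<in> S \<Longrightarrow> parents E u \<subseteq> S"
  shows "margin M S (joint_law V E M f) = joint_law S E M f"
  using assms
proof (induction "card (V - S)" arbitrary: S)
  case 0
  then have "S = V" using finite_vertices by auto
  \<comment> \<open>Points of \<open>PiM V M\<close> are extensional on \<open>V\<close>, so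
    restriction to \<open>V\<close> is the identity on them.\<close>
  have "margin M V (joint_law V E M f) = distr (joint_law V E M f) (joint_law V E M f) (\<lambda>\<omega>. \<omega>)"
    unfolding margin_def
    by (intro distr_cong) (auto simp: sets_joint_law space_joint_law space_PiM)
  then show ?case using \<open>S = V\<close> by simp
next
  case (Suc n)
  have "wf E"
    using dag finite_subset[of E "V \<times> V"] by (auto simp: finite_dag_def intro: finite_acyclic_wf)
  moreover have "V - S \<noteq> {}" using Suc(2) by (metis card.empty nat.distinct(1))
  ultimately obtain v where v: "v \<in> V - S" "\<And>u. (u, v) \<in> E \<Longrightarrow> u \<notin> V - S"
    by (metis wfE_min ex_in_conv)
  then have pv: "parents E v \<subseteq> S"
    using parents_subset_vertices[of v] by (auto simp: parents_def)
  have J: "margin M (insert v S) (joint_law V E M f) = joint_law (insert v S) E M f"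
  proof (rule Suc.hyps(1))
    show "n = card (V - insert v S)"
      using Suc(2) v finite_vertices by (metis Diff_insert card_Diff_singleton diff_Suc_1)
  qed (use Suc.prems v pv in auto)
  have "margin M S (joint_law V E M f) = margin M S (margin M (insert v S) (joint_law V E M f))"
    unfolding margin_def
  proof (subst distr_distr)
    show "(\<lambda>\<omega>. restrict \<omega> S) \<in> measurable (PiM (insert v S) M) (PiM S M)"
      by (rule measurable_restrict_subset) auto
    show "(\<lambda>\<omega>. restrict \<omega> (insert v S)) \<in> measurable (joint_law V E M f) (PiM (insert v S) M)"
      using Suc.prems v unfolding measurable_cong_sets[OF sets_joint_law refl]
      by (intro measurable_restrict_subset) auto
  qed (auto simp: comp_def intro!: distr_cong)
  also have "\<dots> = joint_law S E M f"
    unfolding J using Suc.prems v pv by (intro margin_joint_law_insert) auto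
  finally show ?case .
qed

text \<open>The event is the preimage of an event about \<open>S\<close> under restriction, so its
  probability can be computed in the margin over \<open>S\<close>, where only the factors of
  \<open>S\<close> are left.\<close>

lemma emeasure_joint_law_ancestral:
  assumes S: "S \<subseteq> V" "\<And>u. u \<in> S \<Longrightarrow> parents E u \<subseteq> S"
    and \<phi>: "Measurable.pred (PiM S M) \<phi>" "\<And>\<omega>. \<omega> \<in> space (PiM V M) \<Longrightarrow> \<phi> (restrict \<omega> S) = \<phi> \<omega>"
  shows "emeasure (joint_law V E M f) {\<omega> \<in> space (PiM V M). \<phi> \<omega>} =
    (\<integral>\<^sup>+\<omega>. (\<Prod>v\<in>S. model_factor E f v \<omega>) * indicator {\<omega>. \<phi> \<omega>} \<omega> \<partial>PiM S M)"
proof -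
  have A[measurable]: "{\<omega> \<in> space (PiM S M). \<phi> \<omega>} \<in> sets (PiM S M)" using \<phi>(1) by measurable
  have [measurable]: "(\<lambda>\<omega>. restrict \<omega> S) \<in> measurable (joint_law V E M f) (PiM S M)"
    using S(1) unfolding measurable_cong_sets[OF sets_joint_law refl]
    by (rule measurable_restrict_subset)
  have [measurable]: "(\<lambda>\<omega>. \<Prod>u\<in>S. model_factor E f u \<omega>) \<in> borel_measurable (PiM S M)"
    using S by (auto intro!: borel_measurable_prod_model_factor)
  have "(\<lambda>\<omega>. restrict \<omega> S) -` {\<omega> \<in> space (PiM S M). \<phi> \<omega>} \<inter> space (joint_law V E M f) =
      {\<omega> \<in> space (PiM V M). \<phi> \<omega>}"
    using S(1) \<phi>(2) by (auto simp: space_joint_law space_PiM)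
  then have "emeasure (joint_law V E M f) {\<omega> \<in> space (PiM V M). \<phi> \<omega>} =
      emeasure (margin M S (joint_law V E M f)) {\<omega> \<in> space (PiM S M). \<phi> \<omega>}"
    unfolding margin_def by (subst emeasure_distr) auto
  also have "\<dots> = emeasure (joint_law S E M f) {\<omega> \<in> space (PiM S M). \<phi> \<omega>}"
    using S by (subst margin_joint_law) auto
  also have "\<dots> = (\<integral>\<^sup>+\<omega>. (\<Prod>v\<in>S. model_factor E f v \<omega>) * indicator {\<omega>. \<phi> \<omega>} \<omega> \<partial>PiM S M)"
    unfolding joint_law_def
    by (subst emeasure_density) (auto intro!: nn_integral_cong split: split_indicator)
  finally show ?thesis .
qed

lemma prob_space_joint_law: "prob_space (joint_law V E M f)"
proof
  show "emeasure (joint_law V E M f) (space (joint_law V E M f)) = 1"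
    \<comment> \<open>For the empty ancestral set the integrand is 1 and \<open>PiM {} M\<close> is
      a single point of mass 1.\<close>
    using emeasure_joint_law_ancestral[of "{}" "\<lambda>_. True"]
    by (simp add: space_joint_law PiM_empty)
qed

end

section \<open>Interventional laws as laws of a modified DAG model\<close>

definition cut_incoming :: "('v \<times> 'v) set \<Rightarrow> 'v set \<Rightarrow> ('v \<times> 'v) set" where
  "cut_incoming E I = {(u, v) \<in> E. v \<notin> I}"

lemma parents_cut_incoming: "parents (cut_incoming E I) v = (if v \<in> I then {} else parents E v)"
  by (auto simp: parents_def cut_incoming_def)

text \<open>An intervened vertex loses its parents and gets a point mass as its density with respect
  to counting measure. In this way an interventional law is itself the joint law of a DAG
  model.\<close>

definition do_densities ::
  "('v \<Rightarrow> ('v \<Rightarrow> 'a) \<Rightarrow> 'a \<Rightarrow> ennreal) \<Rightarrow> 'v set \<Rightarrow> ('v \<Rightarrow> 'a) \<Rightarrow> 'v \<Rightarrow> ('v \<Rightarrow> 'a) \<Rightarrow> 'a \<Rightarrow> ennreal" where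
  "do_densities f I a v w t = (if v \<in> I then indicator {a v} t else f v w t)"

lemma model_factor_do:
  "model_factor (cut_incoming E I) (do_densities f I a) v \<omega> =
     (if v \<in> I then indicator {a v} (\<omega> v) else model_factor E f v \<omega>)"
  by (simp add: model_factor_def do_densities_def parents_cut_incoming)

lemma prod_model_factor_do:
  assumes "finite S" "I \<subseteq> S"
  shows "(\<Prod>v\<in>S. model_factor (cut_incoming E I) (do_densities f I a) v \<omega>) =
     (\<Prod>v\<in>S - I. model_factor E f v \<omega>) * (\<Prod>v\<in>I. indicator {a v} (\<omega> v))"
  by (simp add: prod.subset_diff[OF assms(2,1)] model_factor_do)

lemma do_law_eq_joint_law:
  assumes "finite V" "I \<subseteq> V"
  shows "do_law V E M f I a = joint_law V (cut_incoming E I) M (do_densities f I a)"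
  unfolding do_law_def joint_law_def using assms by (simp add: prod_model_factor_do)

lemma takes_restrict: "T \<subseteq> S \<Longrightarrow> takes (restrict \<omega> S) T t \<longleftrightarrow> takes \<omega> T t"
  by (auto simp: takes_def)

lemma prod_indicator_takes:
  "finite T \<Longrightarrow> (\<Prod>v\<in>T. indicator {t v} (\<omega> v)) = (indicator {\<omega>. takes \<omega> T t} \<omega> :: ennreal)"
  by (induction T rule: finite_induct) (auto simp: takes_def split: split_indicator)

lemma count_space_sets:
  assumes "N = count_space (space N)"
  shows "sets N = Pow (space N)"
  using arg_cong[OF assms, of sets] by simp

lemma count_space_singleton:
  assumes "N = count_space (space N)" "x \<in> space N"
  shows "{x} \<in> sets N" "emeasure N {x} = 1"
  using assms(2) arg_cong[OF assms(1), of "\<lambda>N. emeasure N {x}"]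
  by (simp_all add: count_space_sets[OF assms(1)])

lemma pred_component:
  assumes "v \<in> U" "M v = count_space (space (M v))"
  shows "Measurable.pred (PiM U M) (\<lambda>\<omega>. \<omega> v \<in> W)"
proof -
  have "W \<inter> space (M v) \<in> sets (M v)" by (simp add: count_space_sets[OF assms(2)])
  from measurable_sets[OF measurable_component_singleton[OF assms(1), of M] this]
  have "{\<omega> \<in> space (PiM U M). \<omega> v \<in> W} \<in> sets (PiM U M)"
    by (rule back_subst[of "\<lambda>A. A \<in> sets (PiM U M)"]) (use assms(1) in \<open>auto simp: space_PiM\<close>)
  then show ?thesis by (simp add: pred_def)
qed

lemma pred_takes:
  assumes "finite T" "T \<subseteq> U" "\<And>v. v \<in> T \<Longrightarrow> M v = count_space (space (M v))"
  shows "Measurable.pred (PiM U M) (\<lambda>\<omega>. takes \<omega> T t)"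
proof -
  have "Measurable.pred (PiM U M) (\<lambda>\<omega>. \<forall>v\<in>T. \<omega> v \<in> {t v})"
    using assms by (intro pred_intros_finite pred_component) auto
  then show ?thesis by (simp add: takes_def)
qed

context dag_model
begin

text \<open>Cutting edges preserves acyclicity, and a point mass at an admissible state is
  normalised for counting measure. Facts about joint laws thereby carry over to interventional
  laws.\<close>

lemma do_model:
  assumes I: "I \<subseteq> V" "\<And>v. v \<in> I \<Longrightarrow> M v = count_space (space (M v))"
    "\<And>v. v \<in> I \<Longrightarrow> a v \<in> space (M v)"
  shows "dag_model M V (cut_incoming E I) (do_densities f I a)"
proof
  show "finite_dag V (cut_incoming E I)"
    using dag by (auto simp: finite_dag_def cut_incoming_def intro: acyclic_subset)
  show "conditional_densities V (cut_incoming E I) M (do_densities f I a)"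
    unfolding conditional_densities_def
  proof
    fix v assume v: "v \<in> V"
    show "(\<lambda>(w, t). do_densities f I a v w t)
        \<in> borel_measurable (PiM (parents (cut_incoming E I) v) M \<Otimes>\<^sub>M M v) \<and>
      (\<forall>w\<in>space (PiM (parents (cut_incoming E I) v) M). (\<integral>\<^sup>+t. do_densities f I a v w t \<partial>M v) = 1)"
    proof (cases "v \<in> I")
      case True
      have a[measurable]: "{a v} \<in> sets (M v)" and one: "emeasure (M v) {a v} = 1"
        using count_space_singleton[OF I(2,3)] True by auto
      have "(\<lambda>(w, t). indicator {a v} t :: ennreal) \<in> borel_measurable (PiM {} M \<Otimes>\<^sub>M M v)"
        by measurable
      then show ?thesis using True a one by (simp add: do_densities_def parents_cut_incoming)
    next
      case False
      then show ?thesis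
        using densities v by (simp add: conditional_densities_def do_densities_def parents_cut_incoming)
    qed
  qed
qed

lemma prob_space_do_law:
  assumes I: "I \<subseteq> V" "\<And>v. v \<in> I \<Longrightarrow> M v = count_space (space (M v))"
    "\<And>v. v \<in> I \<Longrightarrow> a v \<in> space (M v)"
  shows "prob_space (do_law V E M f I a)"
  unfolding do_law_eq_joint_law[OF finite_vertices I(1)]
  using I by (intro dag_model.prob_space_joint_law do_model)

text \<open>With respect to counting measure, the density at a point is the probability of that
  point.\<close>

lemma model_factor_le_1:
  assumes v: "v \<in> V" "M v = count_space (space (M v))" and \<omega>: "\<omega> \<in> space (PiM V M)"
  shows "model_factor E f v \<omega> \<le> 1"
proof -
  let ?w = "restrict \<omega> (parents E v)"
  have w: "?w \<in> space (PiM (parents E v) M)" and t: "\<omega> v \<in> space (M v)"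
    using \<omega> parents_subset_vertices[of v] v(1) by (auto simp: space_PiM)
  have s: "{\<omega> v} \<in> sets (M v)" "emeasure (M v) {\<omega> v} = 1"
    using count_space_singleton[OF v(2) t] by auto
  have "f v ?w (\<omega> v) = (\<integral>\<^sup>+t. f v ?w t * indicator {\<omega> v} t \<partial>M v)"
    using s by simp
  also have "\<dots> \<le> (\<integral>\<^sup>+t. f v ?w t \<partial>M v)"
    by (intro nn_integral_mono) (auto split: split_indicator)
  also have "\<dots> = 1" using densities v w by (auto simp: conditional_densities_def)
  finally show ?thesis by (simp add: model_factor_def)
qed

text \<open>Where \<open>D\<close> takes the value \<open>d\<close>, the two densities differ by the
  factors of \<open>D\<close>, each at most 1.\<close>

lemma emeasure_joint_law_le_do_law:
  assumes D: "D \<subseteq> V" "\<And>v. v \<in> D \<Longrightarrow> M v = count_space (space (M v))"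
    and \<phi>: "Measurable.pred (PiM V M) \<phi>"
  shows "emeasure (joint_law V E M f) {\<omega> \<in> space (PiM V M). \<phi> \<omega> \<and> takes \<omega> D d}
    \<le> emeasure (do_law V E M f D d) {\<omega> \<in> space (PiM V M). \<phi> \<omega>}"
proof -
  have finD: "finite D" using D(1) finite_vertices by (rule finite_subset)
  note [measurable] = \<phi> pred_takes[OF finD D(1), of M d, OF D(2)]
  have [measurable]: "(\<lambda>\<omega>. \<Prod>v\<in>V. model_factor E f v \<omega>) \<in> borel_measurable (PiM V M)"
    "(\<lambda>\<omega>. \<Prod>v\<in>V - D. model_factor E f v \<omega>) \<in> borel_measurable (PiM V M)"
    using parents_subset_vertices by (auto intro!: borel_measurable_prod_model_factor)
  have le: "(\<Prod>v\<in>V. model_factor E f v \<omega>) \<le> (\<Prod>v\<in>V - D. model_factor E f v \<omega>)"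
    if "\<omega> \<in> space (PiM V M)" for \<omega>
  proof -
    have "(\<Prod>v\<in>D. model_factor E f v \<omega>) \<le> (\<Prod>v\<in>D. 1)"
      using that D by (intro prod_mono_ennreal model_factor_le_1) auto
    then show ?thesis
      unfolding prod.subset_diff[OF D(1) finite_vertices]
      using mult_left_mono[of _ 1 "\<Prod>v\<in>V - D. model_factor E f v \<omega>"] by simp
  qed
  have "emeasure (joint_law V E M f) {\<omega> \<in> space (PiM V M). \<phi> \<omega> \<and> takes \<omega> D d} =
      (\<integral>\<^sup>+\<omega>. (\<Prod>v\<in>V. model_factor E f v \<omega>) *
        indicator {\<omega> \<in> space (PiM V M). \<phi> \<omega> \<and> takes \<omega> D d} \<omega> \<partial>PiM V M)"
    unfolding joint_law_def by (rule emeasure_density) measurable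
  also have "\<dots> \<le> (\<integral>\<^sup>+\<omega>. (\<Prod>v\<in>V - D. model_factor E f v \<omega>) * indicator {\<omega>. takes \<omega> D d} \<omega> *
      indicator {\<omega> \<in> space (PiM V M). \<phi> \<omega>} \<omega> \<partial>PiM V M)"
    using le by (intro nn_integral_mono) (auto split: split_indicator)
  also have "\<dots> = emeasure (do_law V E M f D d) {\<omega> \<in> space (PiM V M). \<phi> \<omega>}"
    unfolding do_law_def prod_indicator_takes[OF finD]
  proof (rule emeasure_density[symmetric])
    show "(\<lambda>\<omega>. (\<Prod>v\<in>V - D. model_factor E f v \<omega>) * indicator {\<omega>. takes \<omega> D d} \<omega>)
        \<in> borel_measurable (PiM V M)"
      by measurable
  qed measurable
  finally show ?thesis .
qed

text \<open>Both probabilities are integrals over the ancestors of \<open>T\<close>, and none of the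
  factors there belongs to an intervened vertex.\<close>

lemma emeasure_do_law_nondescendants:
  assumes D: "D \<subseteq> V" "\<And>v. v \<in> D \<Longrightarrow> M v = count_space (space (M v))"
    "\<And>v. v \<in> D \<Longrightarrow> d v \<in> space (M v)"
    and T: "T \<subseteq> V" "\<And>v. v \<in> T \<Longrightarrow> M v = count_space (space (M v))" "D \<inter> anc E T = {}"
  shows "emeasure (do_law V E M f D d) {\<omega> \<in> space (PiM V M). takes \<omega> T t} =
    emeasure (joint_law V E M f) {\<omega> \<in> space (PiM V M). takes \<omega> T t}"
proof -
  interpret D: dag_model M V "cut_incoming E D" "do_densities f D d"
    using D by (rule do_model)
  let ?S = "anc E T"
  have S: "?S \<subseteq> V" using dag T(1) by (intro anc_subset_vertices) (auto simp: finite_dag_def)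
  have closed: "parents E u \<subseteq> ?S" if "u \<in> ?S" for u
    using that anc_parent[of _ u E T] by (auto simp: parents_def)
  have finT: "finite T" using T(1) finite_vertices by (rule finite_subset)
  have pT: "Measurable.pred (PiM ?S M) (\<lambda>\<omega>. takes \<omega> T t)"
    using finT anc_subset T(2) by (rule pred_takes)
  have r: "takes (restrict \<omega> ?S) T t = takes \<omega> T t" for \<omega>
    by (rule takes_restrict) (rule anc_subset)
  have "emeasure (do_law V E M f D d) {\<omega> \<in> space (PiM V M). takes \<omega> T t} =
    (\<integral>\<^sup>+\<omega>. (\<Prod>v\<in>?S. model_factor (cut_incoming E D) (do_densities f D d) v \<omega>) *
       indicator {\<omega>. takes \<omega> T t} \<omega> \<partial>PiM ?S M)"
    unfolding do_law_eq_joint_law[OF finite_vertices D(1)]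
    using closed by (intro D.emeasure_joint_law_ancestral S pT r) (auto simp: parents_cut_incoming)
  also have "\<dots> = (\<integral>\<^sup>+\<omega>. (\<Prod>v\<in>?S. model_factor E f v \<omega>) * indicator {\<omega>. takes \<omega> T t} \<omega> \<partial>PiM ?S M)"
    using T(3) by (intro nn_integral_cong arg_cong2[of _ _ _ _ "(*)"] prod.cong) (auto simp: model_factor_do)
  also have "\<dots> = emeasure (joint_law V E M f) {\<omega> \<in> space (PiM V M). takes \<omega> T t}"
    by (intro emeasure_joint_law_ancestral[symmetric] S pT r closed)
  finally show ?thesis .
qed

text \<open>All of \<open>K\<close> is pinned: \<open>I\<close> by the intervention,
  \<open>K - I\<close> by the event. The integral then splits along \<open>A\<close> and
  \<open>B\<close>. It will be used for \<open>I = D\<close> and for \<open>I = insert X D\<close>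
  with the same \<open>F2\<close>, so that the second integral is common to both.\<close>

lemma emeasure_do_law_split:
  assumes subV: "K \<subseteq> V" "A \<subseteq> V" "B \<subseteq> V" and disj: "K \<inter> A = {}" "K \<inter> B = {}" "A \<inter> B = {}"
    and K: "\<And>v. v \<in> K \<Longrightarrow> M v = count_space (space (M v))" "\<And>v. v \<in> K \<Longrightarrow> k v \<in> space (M v)"
    and I: "I \<subseteq> K"
    and F: "F1 \<inter> F2 = {}" "F1 \<union> F2 = (K \<union> (A \<union> B)) - I"
    and F1: "\<And>v. v \<in> F1 \<Longrightarrow> insert v (parents E v) \<subseteq> K \<union> A"
    and F2: "\<And>v. v \<in> F2 \<Longrightarrow> insert v (parents E v) \<subseteq> K \<union> B"
    and Y: "Y \<in> B" "M Y = count_space (space (M Y))"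
  shows "emeasure (do_law V E M f I k) {\<omega> \<in> space (PiM V M). takes \<omega> (K - I) k \<and> \<omega> Y \<in> W} =
    (\<integral>\<^sup>+z. (\<Prod>v\<in>F1. model_factor E f v (merge K A (restrict k K, z))) \<partial>PiM A M) *
    (\<integral>\<^sup>+z. (\<Prod>v\<in>F2. model_factor E f v (merge K B (restrict k K, z))) *
        indicator W (merge K B (restrict k K, z) Y) \<partial>PiM B M)"
proof -
  let ?S = "K \<union> (A \<union> B)"
  have IV: "I \<subseteq> V" using I subV by auto
  interpret I: dag_model M V "cut_incoming E I" "do_densities f I k"
    using IV K I by (intro do_model) auto
  have fin: "finite K" "finite A" "finite B" "finite ?S"
    using subV finite_vertices finite_subset by auto
  have S: "?S \<subseteq> V" using subV by auto
  have FV: "F1 \<subseteq> V" "F2 \<subseteq> V" using F(2) S by auto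
  have "parents E v \<subseteq> ?S" if "v \<in> ?S - I" for v
    using that F(2) F1[of v] F2[of v] by blast
  then have closed: "parents (cut_incoming E I) v \<subseteq> ?S" if "v \<in> ?S" for v
    using that by (auto simp: parents_cut_incoming)
  have p: "Measurable.pred (PiM ?S M) (\<lambda>\<omega>. takes \<omega> (K - I) k \<and> \<omega> Y \<in> W)"
    using fin K(1) Y by (intro pred_intros_logic pred_takes pred_component) auto
  let ?h1 = "\<lambda>\<omega>. \<Prod>v\<in>F1. model_factor E f v \<omega>"
  let ?h2 = "\<lambda>\<omega>. (\<Prod>v\<in>F2. model_factor E f v \<omega>) * indicator W (\<omega> Y) :: ennreal"
  have "emeasure (do_law V E M f I k) {\<omega> \<in> space (PiM V M). takes \<omega> (K - I) k \<and> \<omega> Y \<in> W} =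
    (\<integral>\<^sup>+\<omega>. (\<Prod>v\<in>?S. model_factor (cut_incoming E I) (do_densities f I k) v \<omega>) *
       indicator {\<omega>. takes \<omega> (K - I) k \<and> \<omega> Y \<in> W} \<omega> \<partial>PiM ?S M)"
    unfolding do_law_eq_joint_law[OF finite_vertices IV]
    using closed Y takes_restrict[of "K - I" ?S]
    by (intro I.emeasure_joint_law_ancestral S p) (auto simp: Un_assoc)
  also have "\<dots> = (\<integral>\<^sup>+\<omega>. ?h1 (restrict \<omega> (K \<union> A)) * ?h2 (restrict \<omega> (K \<union> B)) *
      (\<Prod>v\<in>K. indicator {k v} (\<omega> v)) \<partial>PiM ?S M)"
  proof (rule nn_integral_cong)
    fix \<omega> :: "'v \<Rightarrow> 'a"
    have r: "model_factor E f v (restrict \<omega> T) = model_factor E f v \<omega>"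
      if "insert v (parents E v) \<subseteq> T" for v T
    proof -
      have "T \<inter> parents E v = parents E v" using that by auto
      then show ?thesis using that by (simp add: model_factor_def restrict_restrict)
    qed
    have "(\<Prod>v\<in>?S. model_factor (cut_incoming E I) (do_densities f I k) v \<omega>) =
        (\<Prod>v\<in>F1 \<union> F2. model_factor E f v \<omega>) * (\<Prod>v\<in>I. indicator {k v} (\<omega> v))"
      unfolding F(2) using fin(4) I by (intro prod_model_factor_do) auto
    also have "(\<Prod>v\<in>F1 \<union> F2. model_factor E f v \<omega>) =
        (\<Prod>v\<in>F1. model_factor E f v \<omega>) * (\<Prod>v\<in>F2. model_factor E f v \<omega>)"
      using F(1) FV finite_vertices finite_subset by (intro prod.union_disjoint) auto
    also have "(\<Prod>v\<in>F1. model_factor E f v \<omega>) = ?h1 (restrict \<omega> (K \<union> A))"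
      using F1 by (intro prod.cong refl r[symmetric])
    also have "(\<Prod>v\<in>F2. model_factor E f v \<omega>) = (\<Prod>v\<in>F2. model_factor E f v (restrict \<omega> (K \<union> B)))"
      using F2 by (intro prod.cong refl r[symmetric])
    finally have 1: "(\<Prod>v\<in>?S. model_factor (cut_incoming E I) (do_densities f I k) v \<omega>) =
        ?h1 (restrict \<omega> (K \<union> A)) * (\<Prod>v\<in>F2. model_factor E f v (restrict \<omega> (K \<union> B))) *
        (\<Prod>v\<in>I. indicator {k v} (\<omega> v))" .
    \<comment> \<open>The event supplies the indicators for \<open>K - I\<close>; together with
      those of the intervention they range over \<open>K\<close>.\<close>
    have 2: "indicator {\<omega>. takes \<omega> (K - I) k \<and> \<omega> Y \<in> W} \<omega> =
        (\<Prod>v\<in>K - I. indicator {k v} (\<omega> v)) * (indicator W (restrict \<omega> (K \<union> B) Y) :: ennreal)"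
      using fin Y by (subst prod_indicator_takes) (auto split: split_indicator)
    show "(\<Prod>v\<in>?S. model_factor (cut_incoming E I) (do_densities f I k) v \<omega>) *
        indicator {\<omega>. takes \<omega> (K - I) k \<and> \<omega> Y \<in> W} \<omega> =
      ?h1 (restrict \<omega> (K \<union> A)) * ?h2 (restrict \<omega> (K \<union> B)) * (\<Prod>v\<in>K. indicator {k v} (\<omega> v))"
      unfolding 1 2 prod.subset_diff[OF I fin(1)] by (simp only: mult_ac)
  qed
  also have "\<dots> = (\<integral>\<^sup>+z. ?h1 (merge K A (restrict k K, z)) \<partial>PiM A M) *
           (\<integral>\<^sup>+z. ?h2 (merge K B (restrict k K, z)) \<partial>PiM B M)"
  proof (rule nn_integral_fixed_split[OF fin(1-3) disj])
    show "{k v} \<in> sets (M v)" "emeasure (M v) {k v} = 1" if "v \<in> K" for v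
      using count_space_singleton[OF K] that by auto
    show "?h1 \<in> borel_measurable (PiM (K \<union> A) M)"
      using F1 FV by (intro borel_measurable_prod_model_factor) auto
    have "(\<lambda>\<omega>. \<Prod>v\<in>F2. model_factor E f v \<omega>) \<in> borel_measurable (PiM (K \<union> B) M)"
      using F2 FV by (intro borel_measurable_prod_model_factor) auto
    moreover have "Measurable.pred (PiM (K \<union> B) M) (\<lambda>\<omega>. \<omega> Y \<in> W)"
      using Y by (intro pred_component) auto
    then have "(\<lambda>\<omega>. indicator {\<omega>. \<omega> Y \<in> W} \<omega> :: ennreal) \<in> borel_measurable (PiM (K \<union> B) M)"
      by measurable
    then have "(\<lambda>\<omega>. indicator W (\<omega> Y) :: ennreal) \<in> borel_measurable (PiM (K \<union> B) M)"
      by (simp add: indicator_def)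
    ultimately show "?h2 \<in> borel_measurable (PiM (K \<union> B) M)"
      by (rule borel_measurable_times_ennreal)
  qed
  finally show ?thesis .
qed

end

section \<open>Bounds on interventional probabilities\<close>

lemma do_law_cong:
  "(\<And>v. v \<in> I \<Longrightarrow> a v = b v) \<Longrightarrow> do_law V E M f I a = do_law V E M f I b"
  unfolding do_law_def
  by (intro arg_cong[of _ _ "density _"] ext arg_cong2[of _ _ _ _ "(*)"] prod.cong refl) simp

lemma measure_margin:
  assumes "W \<subseteq> V" "sets \<mu> = sets (PiM V M)" "Measurable.pred (PiM W M) \<phi>" "\<And>\<omega>. \<phi> (restrict \<omega> W) = \<phi> \<omega>"
  shows "\<P>(\<omega> in margin M W \<mu>. \<phi> \<omega>) = \<P>(\<omega> in \<mu>. \<phi> \<omega>)"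
proof -
  have sp: "space \<mu> = space (PiM V M)" using assms(2) by (rule sets_eq_imp_space_eq)
  have [measurable]: "{\<omega> \<in> space (PiM W M). \<phi> \<omega>} \<in> sets (PiM W M)" using assms(3) by measurable
  have [measurable]: "(\<lambda>\<omega>. restrict \<omega> W) \<in> measurable \<mu> (PiM W M)"
    unfolding measurable_cong_sets[OF assms(2) refl] using assms(1) by (rule measurable_restrict_subset)
  have "(\<lambda>\<omega>. restrict \<omega> W) -` {\<omega> \<in> space (PiM W M). \<phi> \<omega>} \<inter> space \<mu> = {\<omega> \<in> space \<mu>. \<phi> \<omega>}"
    using assms(1,4) unfolding sp by (auto simp: space_PiM)
  then show ?thesis
    unfolding margin_def by (subst measure_distr) auto
qed

text \<open>The quotient \<open>u / (u + w)\<close> increases in \<open>u\<close> and decreases in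
  \<open>w\<close>, so its extremes are at \<open>u = a\<close>, \<open>w = b + e\<close> and at
  \<open>u = a + e\<close>, \<open>w = b\<close>. The form \<open>r * (u + w) = u\<close> admits
  \<open>u + w = 0\<close>; then \<open>a = b = 0\<close>, and the bounds reduce to 0 and 1.\<close>

lemma quotient_bounds:
  fixes a b u w e r :: real
  assumes "0 \<le> a" "a \<le> u" "u \<le> a + e" "0 \<le> b" "b \<le> w" "w \<le> b + e" "0 \<le> e" "a + b + e > 0"
    and r: "r * (u + w) = u" "0 \<le> r" "r \<le> 1"
  shows "a / (a + b + e) \<le> r" "r \<le> (a + e) / (a + b + e)"
proof -
  have "a * (u + w) \<le> u * (a + b + e)" "u * (a + b + e) \<le> (a + e) * (u + w)"
  proof -
    have "a * w \<le> u * (b + e)" using assms by (intro mult_mono) auto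
    then show "a * (u + w) \<le> u * (a + b + e)" by (simp add: algebra_simps)
    have "u * b \<le> (a + e) * w" using assms by (intro mult_mono) auto
    then show "u * (a + b + e) \<le> (a + e) * (u + w)" by (simp add: algebra_simps)
  qed
  then have *: "a * (u + w) \<le> r * (a + b + e) * (u + w)" "r * (a + b + e) * (u + w) \<le> (a + e) * (u + w)"
    using r(1) by (metis mult.assoc mult.commute)+
  have "a \<le> r * (a + b + e) \<and> r * (a + b + e) \<le> a + e"
  proof (cases "u + w > 0")
    case True
    then show ?thesis using * by (simp add: mult_le_cancel_right)
  next
    case False
    then have "a = 0" "b = 0" using assms by auto
    then show ?thesis using assms mult_right_mono[of r 1 e] by simp
  qed
  then show "a / (a + b + e) \<le> r" "r \<le> (a + e) / (a + b + e)"
    using assms(8) by (auto simp: divide_le_eq le_divide_eq)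
qed

context dag_model
begin

lemma sets_do_law: "sets (do_law V E M f I a) = sets (PiM V M)"
  by (simp add: do_law_def)

lemma space_do_law: "space (do_law V E M f I a) = space (PiM V M)"
  by (simp add: do_law_def)

text \<open>The second rule of the do-calculus, multiplied out so that it needs no positivity.\<close>

lemma action_observation_exchange:
  assumes disc: "\<And>v. v \<in> insert X (insert Y (C \<union> D)) \<Longrightarrow> v \<in> V \<and> M v = count_space (space (M v))"
    and disjoint: "X \<noteq> Y" "X \<notin> C" "X \<notin> D" "Y \<notin> C" "Y \<notin> D" "C \<inter> D = {}"
    and e_sep: "e_separated V (E - {(X, Y)}) {X} {Y} C D"
    and x: "x \<in> space (M X)" and c: "c \<in> space (PiM C M)" and d: "d \<in> space (PiM D M)"
  shows "\<P>(\<omega> in do_law V E M f D d. \<omega> X = x \<and> takes \<omega> C c) *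
       \<P>(\<omega> in do_law V E M f (insert X D) (d(X := x)). \<omega> Y = y \<and> takes \<omega> C c) =
     \<P>(\<omega> in do_law V E M f D d. \<omega> X = x \<and> \<omega> Y = y \<and> takes \<omega> C c) *
       \<P>(\<omega> in do_law V E M f (insert X D) (d(X := x)). takes \<omega> C c)"
proof -
  define K where "K = insert X (C \<union> D)"
  \<comment> \<open>One assignment for all fixed vertices, so that both interventions are evaluated
    at the same point.\<close>
  define k where "k v = (if v = X then x else if v \<in> D then d v else c v)" for v
  have sub: "X \<in> V" "Y \<in> V" "C \<subseteq> V" "D \<subseteq> V" using disc by auto
  obtain A B F where AB: "A \<subseteq> V" "B \<subseteq> V" "K \<inter> A = {}" "K \<inter> B = {}" "A \<inter> B = {}"
      "Y \<in> B" "X \<in> F" "F \<subseteq> insert X (C \<union> (A \<union> B))"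
    and F: "\<And>v. v \<in> F \<Longrightarrow> insert v (parents E v) \<subseteq> K \<union> A"
      "\<And>v. v \<in> insert X (C \<union> (A \<union> B)) - F \<Longrightarrow> insert v (parents E v) \<subseteq> K \<union> B"
  proof (rule e_separated_split[OF dag sub(1,2) disjoint(1) sub(3,4) disjoint(6,2,3,4,5) e_sep, folded K_def],
      goal_cases)
    case (1 A B F)
    show ?case by (rule 1(1)[OF 1(2-)])
  qed
  have K: "K \<subseteq> V" "\<And>v. v \<in> K \<Longrightarrow> M v = count_space (space (M v))" "\<And>v. v \<in> K \<Longrightarrow> k v \<in> space (M v)"
    using disc x c d by (auto simp: K_def k_def space_PiM)
  have KI: "K - D = insert X C" "K - insert X D = C"
    using disjoint by (auto simp: K_def)
  let ?F2 = "insert X (C \<union> (A \<union> B)) - F"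
  have Kdiff: "K \<union> (A \<union> B) - D = insert X (C \<union> (A \<union> B))"
    "K \<union> (A \<union> B) - insert X D = insert X (C \<union> (A \<union> B)) - {X}"
    using disjoint AB(3,4) by (auto simp: K_def)
  have tX: "takes \<omega> (insert X C) k \<longleftrightarrow> \<omega> X = x \<and> takes \<omega> C c" for \<omega>
    using disjoint by (auto simp: takes_def k_def)
  have tC: "takes \<omega> C k \<longleftrightarrow> takes \<omega> C c" for \<omega>
    using disjoint by (auto simp: takes_def k_def)
  have D1: "do_law V E M f D d = do_law V E M f D k"
    using disjoint by (intro do_law_cong) (auto simp: k_def)
  have D2: "do_law V E M f (insert X D) (d(X := x)) = do_law V E M f (insert X D) k"
    using disjoint by (intro do_law_cong) (auto simp: k_def)
  \<comment> \<open>The interventions \<open>do(d)\<close> and \<open>do(x, d)\<close> differ only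
    in the factor of \<open>X\<close>, hence only in \<open>\<alpha>\<close> and
    \<open>\<alpha>'\<close>. The factor \<open>\<beta>\<close> carries the dependence on
    \<open>Y\<close>, with \<open>W = UNIV\<close> when \<open>Y\<close> is left free, so both sides
    of the claim are the same product.\<close>
  define \<alpha> where "\<alpha> = (\<integral>\<^sup>+z. (\<Prod>v\<in>F. model_factor E f v (merge K A (restrict k K, z))) \<partial>PiM A M)"
  define \<alpha>' where "\<alpha>' = (\<integral>\<^sup>+z. (\<Prod>v\<in>F - {X}. model_factor E f v (merge K A (restrict k K, z))) \<partial>PiM A M)"
  define \<beta> where "\<beta> W = (\<integral>\<^sup>+z. (\<Prod>v\<in>?F2. model_factor E f v (merge K B (restrict k K, z))) *
      indicator W (merge K B (restrict k K, z) Y) \<partial>PiM B M)" for W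
  have Y: "M Y = count_space (space (M Y))" using disc by auto
  have 1: "emeasure (do_law V E M f D k)
      {\<omega> \<in> space (PiM V M). takes \<omega> (K - D) k \<and> \<omega> Y \<in> W} = \<alpha> * \<beta> W" for W
    unfolding \<alpha>_def \<beta>_def
    by (rule emeasure_do_law_split[OF K(1) AB(1-5) K(2,3) _ _ _ F])
       (use AB Y disjoint in \<open>auto simp: Kdiff K_def\<close>)
  have F': "insert v (parents E v) \<subseteq> K \<union> A" if "v \<in> F - {X}" for v
    using that F(1) by blast
  have 2: "emeasure (do_law V E M f (insert X D) k)
      {\<omega> \<in> space (PiM V M). takes \<omega> (K - insert X D) k \<and> \<omega> Y \<in> W} = \<alpha>' * \<beta> W" for W
    unfolding \<alpha>'_def \<beta>_def
    by (rule emeasure_do_law_split[OF K(1) AB(1-5) K(2,3) _ _ _ F' F(2)])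
       (use AB Y disjoint in \<open>auto simp: Kdiff K_def\<close>)
  have 11: "\<P>(\<omega> in do_law V E M f D d. \<omega> X = x \<and> takes \<omega> C c) = enn2real (\<alpha> * \<beta> UNIV)"
    and 12: "\<P>(\<omega> in do_law V E M f D d. \<omega> X = x \<and> \<omega> Y = y \<and> takes \<omega> C c) = enn2real (\<alpha> * \<beta> {y})"
    unfolding 1[symmetric] D1 measure_def KI tX space_do_law
    by (auto intro!: arg_cong[of _ _ enn2real] arg_cong[of _ _ "emeasure _"])
  have 21: "\<P>(\<omega> in do_law V E M f (insert X D) (d(X := x)). takes \<omega> C c) = enn2real (\<alpha>' * \<beta> UNIV)"
    and 22: "\<P>(\<omega> in do_law V E M f (insert X D) (d(X := x)). \<omega> Y = y \<and> takes \<omega> C c) =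
      enn2real (\<alpha>' * \<beta> {y})"
    unfolding 2[symmetric] D2 measure_def KI tC space_do_law
    by (auto intro!: arg_cong[of _ _ enn2real] arg_cong[of _ _ "emeasure _"])
  show ?thesis unfolding 11 12 21 22 by (simp add: enn2real_mult mult_ac)
qed

text \<open>The upper bound is the lower bound for the complement of \<open>\<phi>\<close>, because
  both laws give the event on \<open>T\<close> the same probability. \<open>T\<close> will be
  \<open>C\<close> for the first pair of bounds and \<open>insert X C\<close> for the
  second.\<close>

lemma do_law_event_bounds:
  assumes D: "D \<subseteq> V" "\<And>v. v \<in> D \<Longrightarrow> M v = count_space (space (M v))"
    "\<And>v. v \<in> D \<Longrightarrow> d v \<in> space (M v)"
    and T: "T \<subseteq> V" "\<And>v. v \<in> T \<Longrightarrow> M v = count_space (space (M v))" "D \<inter> anc E T = {}"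
    and \<phi>: "Measurable.pred (PiM V M) \<phi>"
  shows "\<P>(\<omega> in joint_law V E M f. \<phi> \<omega> \<and> takes \<omega> D d \<and> takes \<omega> T t)
      \<le> \<P>(\<omega> in do_law V E M f D d. \<phi> \<omega> \<and> takes \<omega> T t)"
    and "\<P>(\<omega> in do_law V E M f D d. \<phi> \<omega> \<and> takes \<omega> T t)
      \<le> \<P>(\<omega> in joint_law V E M f. \<phi> \<omega> \<and> takes \<omega> D d \<and> takes \<omega> T t)
        + (\<P>(\<omega> in joint_law V E M f. takes \<omega> T t) - \<P>(\<omega> in joint_law V E M f. takes \<omega> D d \<and> takes \<omega> T t))"
proof -
  interpret p: prob_space "joint_law V E M f" by (rule prob_space_joint_law)
  interpret q: prob_space "do_law V E M f D d" using D by (rule prob_space_do_law)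
  have fin: "finite D" "finite T" using D(1) T(1) finite_vertices finite_subset by auto
  note [measurable_cong] = sets_do_law
  note [measurable] = pred_takes[OF fin(1) D(1), of M d, OF D(2)] pred_takes[OF fin(2) T(1), of M t, OF T(2)]
  have le: "\<P>(\<omega> in joint_law V E M f. \<psi> \<omega> \<and> takes \<omega> D d \<and> takes \<omega> T t)
      \<le> \<P>(\<omega> in do_law V E M f D d. \<psi> \<omega> \<and> takes \<omega> T t)"
    if [measurable]: "Measurable.pred (PiM V M) \<psi>" for \<psi>
  proof -
    have "emeasure (joint_law V E M f) {\<omega> \<in> space (PiM V M). (\<psi> \<omega> \<and> takes \<omega> T t) \<and> takes \<omega> D d}
      \<le> emeasure (do_law V E M f D d) {\<omega> \<in> space (PiM V M). \<psi> \<omega> \<and> takes \<omega> T t}"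
      by (rule emeasure_joint_law_le_do_law[OF D(1,2)]) measurable
    then show ?thesis
      by (simp add: p.emeasure_eq_measure q.emeasure_eq_measure space_joint_law space_do_law conj_ac)
  qed
  show "\<P>(\<omega> in joint_law V E M f. \<phi> \<omega> \<and> takes \<omega> D d \<and> takes \<omega> T t)
      \<le> \<P>(\<omega> in do_law V E M f D d. \<phi> \<omega> \<and> takes \<omega> T t)"
    using \<phi> by (rule le)
  note [measurable] = \<phi>
  have eq: "\<P>(\<omega> in do_law V E M f D d. takes \<omega> T t) = \<P>(\<omega> in joint_law V E M f. takes \<omega> T t)"
    using emeasure_do_law_nondescendants[OF D T, of t]
    by (simp add: measure_def space_joint_law space_do_law)
  have "\<P>(\<omega> in do_law V E M f D d. takes \<omega> T t) =
      \<P>(\<omega> in do_law V E M f D d. \<phi> \<omega> \<and> takes \<omega> T t) + \<P>(\<omega> in do_law V E M f D d. \<not> \<phi> \<omega> \<and> takes \<omega> T t)"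
    by (subst q.finite_measure_Union[symmetric]) (auto intro!: arg_cong[of _ _ q.prob])
  moreover have "\<P>(\<omega> in joint_law V E M f. takes \<omega> D d \<and> takes \<omega> T t) =
      \<P>(\<omega> in joint_law V E M f. \<phi> \<omega> \<and> takes \<omega> D d \<and> takes \<omega> T t) +
      \<P>(\<omega> in joint_law V E M f. \<not> \<phi> \<omega> \<and> takes \<omega> D d \<and> takes \<omega> T t)"
    by (subst p.finite_measure_Union[symmetric]) (auto intro!: arg_cong[of _ _ p.prob])
  moreover have "\<P>(\<omega> in joint_law V E M f. \<not> \<phi> \<omega> \<and> takes \<omega> D d \<and> takes \<omega> T t)
      \<le> \<P>(\<omega> in do_law V E M f D d. \<not> \<phi> \<omega> \<and> takes \<omega> T t)"
    by (rule le) measurable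
  ultimately show "\<P>(\<omega> in do_law V E M f D d. \<phi> \<omega> \<and> takes \<omega> T t)
      \<le> \<P>(\<omega> in joint_law V E M f. \<phi> \<omega> \<and> takes \<omega> D d \<and> takes \<omega> T t)
        + (\<P>(\<omega> in joint_law V E M f. takes \<omega> T t) - \<P>(\<omega> in joint_law V E M f. takes \<omega> D d \<and> takes \<omega> T t))"
    using eq by linarith
qed

end

text \<open>In the first part, \<open>q(x, c)\<close> is only known up to the error
  \<open>p(c) - p(d, c)\<close>, so the quotient \<open>q(x, y, c) / q(x, c)\<close> is bounded by
  monotonicity. In the second part \<open>q(x, c) = p(x, c)\<close> exactly, and only the numerator
  has to be bounded.\<close>

lemma (in dag_model) do_prob_bounds:
  fixes H C D :: "'v set" and X Y :: 'v and x y :: 'a and c d :: "'v \<Rightarrow> 'a"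
  defines "W \<equiv> V - H"
  defines "P \<equiv> margin M W (joint_law V E M f)"
  defines "Q \<equiv> \<lambda>I a. margin M W (do_law V E M f I a)"
  assumes observable: "X \<in> W" "Y \<in> W" "C \<subseteq> W" "D \<subseteq> W"
    and disc: "\<And>v. v \<in> W \<Longrightarrow> M v = count_space (space (M v))"
    and disjoint: "X \<noteq> Y" "X \<notin> C" "X \<notin> D" "Y \<notin> C" "Y \<notin> D" "C \<inter> D = {}"
    and C_not_desc: "\<forall>v\<in>C. \<forall>w\<in>D. \<not> descendant E v w"
    and e_sep: "e_separated V (E - {(X, Y)}) {X} {Y} C D"
    and x: "x \<in> space (M X)" and c: "c \<in> space (PiM C M)" and d: "d \<in> space (PiM D M)"
    and do_def: "do_defined Q X C D x d c"
  shows "\<lbrakk>\<P>(\<omega> in P. takes \<omega> C c) > 0; bound_denom P X C D x d c \<noteq> 0\<rbrakk> \<Longrightarrow>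
      lower_bound P X Y C D x y d c \<le> do_prob Q X Y C D x y d c \<and>
      do_prob Q X Y C D x y d c \<le> upper_bound P X Y C D x y d c"
    and "\<lbrakk>\<forall>w\<in>D. \<not> descendant E X w; \<P>(\<omega> in P. \<omega> X = x \<and> takes \<omega> C c) > 0\<rbrakk> \<Longrightarrow>
      lower_bound' P X Y C D x y d c \<le> do_prob Q X Y C D x y d c \<and>
      do_prob Q X Y C D x y d c \<le> upper_bound' P X Y C D x y d c"
proof -
  let ?J = "joint_law V E M f" and ?J1 = "do_law V E M f D d"
    and ?J2 = "do_law V E M f (insert X D) (d(X := x))"
  have WV: "W \<subseteq> V" by (simp add: W_def)
  have sub: "C \<subseteq> V" "D \<subseteq> V" "X \<in> V" using WV observable by auto
  have fin: "finite C" "finite D"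
    using sub finite_vertices finite_subset by auto
  have Dd: "\<And>v. v \<in> D \<Longrightarrow> M v = count_space (space (M v))" "\<And>v. v \<in> D \<Longrightarrow> d v \<in> space (M v)"
    using disc observable d by (auto simp: space_PiM)
  \<comment> \<open>The events that concern observable variables only: these have the same
    probability under the full law and under its margin.\<close>
  define ok where "ok \<phi> \<longleftrightarrow> Measurable.pred (PiM W M) \<phi> \<and> (\<forall>\<omega>. \<phi> (restrict \<omega> W) = \<phi> \<omega>)"
    for \<phi> :: "('v \<Rightarrow> 'a) \<Rightarrow> bool"
  have ok_eq: "ok (\<lambda>\<omega>. \<omega> v = a)" if "v \<in> W" for v a
    using pred_component[of v W M "{a}"] that disc by (auto simp: ok_def)
  have ok_takes: "ok (\<lambda>\<omega>. takes \<omega> T t)" if "T \<subseteq> W" "finite T" for T t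
    using pred_takes[of T W M t] that disc takes_restrict[of T W] by (auto simp: ok_def)
  have ok_conj: "ok (\<lambda>\<omega>. \<phi> \<omega> \<and> \<psi> \<omega>)" if "ok \<phi>" "ok \<psi>" for \<phi> \<psi>
    using that by (auto simp: ok_def intro: pred_intros_logic)
  note oks = ok_conj ok_eq ok_takes observable fin
  have P: "\<P>(\<omega> in P. \<phi> \<omega>) = \<P>(\<omega> in ?J. \<phi> \<omega>)" if "ok \<phi>" for \<phi>
    unfolding P_def using that WV sets_joint_law by (intro measure_margin) (auto simp: ok_def)
  have Q: "\<P>(\<omega> in Q (insert X D) (d(X := x)). \<phi> \<omega>) = \<P>(\<omega> in ?J2. \<phi> \<omega>)" if "ok \<phi>" for \<phi>
    unfolding Q_def using that WV sets_do_law by (intro measure_margin) (auto simp: ok_def)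
  interpret p: prob_space ?J by (rule prob_space_joint_law)
  interpret q: prob_space ?J1 using sub(2) Dd by (rule prob_space_do_law)
  interpret q2: prob_space ?J2
    using sub x Dd disc observable by (intro prob_space_do_law) auto
  note [measurable_cong] = sets_do_law
  have pX[measurable]: "Measurable.pred (PiM V M) (\<lambda>\<omega>. \<omega> X = a)" for a
    using pred_component[of X V M "{a}"] WV observable(1) disc by auto
  have pY[measurable]: "Measurable.pred (PiM V M) (\<lambda>\<omega>. \<omega> Y = a)" for a
    using pred_component[of Y V M "{a}"] WV observable(2) disc by auto
  have pC[measurable]: "Measurable.pred (PiM V M) (\<lambda>\<omega>. takes \<omega> C c)"
    using fin(1) sub(1) disc observable by (intro pred_takes) auto
  have pD[measurable]: "Measurable.pred (PiM V M) (\<lambda>\<omega>. takes \<omega> D d)"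
    using fin(2) sub(2) disc observable by (intro pred_takes) auto

  define rho where "rho = do_prob Q X Y C D x y d c"
  have okC: "ok (\<lambda>\<omega>. takes \<omega> C c)" and okYC: "ok (\<lambda>\<omega>. \<omega> Y = y \<and> takes \<omega> C c)"
    by (intro oks)+
  have rho: "rho = \<P>(\<omega> in ?J2. \<omega> Y = y \<and> takes \<omega> C c) / \<P>(\<omega> in ?J2. takes \<omega> C c)"
    unfolding rho_def do_prob_def cond_prob_def Q[OF okC] Q[OF okYC] ..
  have pos2: "\<P>(\<omega> in ?J2. takes \<omega> C c) > 0"
    using do_def unfolding do_defined_def Q[OF okC] .
  have rho01: "0 \<le> rho" "rho \<le> 1"
    unfolding rho using pos2 by (auto intro!: divide_nonneg_pos q2.finite_measure_mono simp: divide_le_eq_1)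
  \<comment> \<open>In product form this also holds if \<open>X = x\<close> and \<open>c\<close>
    have joint probability 0 under \<open>do(d)\<close>.\<close>
  have exch: "rho * \<P>(\<omega> in ?J1. \<omega> X = x \<and> takes \<omega> C c) =
      \<P>(\<omega> in ?J1. \<omega> X = x \<and> \<omega> Y = y \<and> takes \<omega> C c)"
    using action_observation_exchange[OF _ disjoint e_sep x c d, of y] disc observable WV pos2
    unfolding rho by (auto simp: field_simps subset_eq)

  {
    assume pos: "\<P>(\<omega> in P. takes \<omega> C c) > 0" and den: "bound_denom P X C D x d c \<noteq> 0"
    have anc: "D \<inter> anc E C = {}"
      using C_not_desc disjoint(6) by (auto simp: anc_def descendant_def rtrancl_eq_or_trancl)
    have discC: "\<And>v. v \<in> C \<Longrightarrow> M v = count_space (space (M v))" using disc observable by auto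
    note b = do_law_event_bounds[OF sub(2) Dd sub(1) discC anc, of _ c]
    \<comment> \<open>Unconditional masses are used throughout: \<open>a1\<close> and
      \<open>a2\<close> are observational, \<open>u\<close> and \<open>w\<close> their counterparts
      under \<open>do(d)\<close>, and \<open>e\<close> is the error term. The conditioning factor
      \<open>pc\<close> cancels from the quotients at the end.\<close>
    define pc where "pc = \<P>(\<omega> in ?J. takes \<omega> C c)"
    define e where "e = pc - \<P>(\<omega> in ?J. takes \<omega> D d \<and> takes \<omega> C c)"
    define a1 where "a1 = \<P>(\<omega> in ?J. (\<omega> X = x \<and> \<omega> Y = y) \<and> takes \<omega> D d \<and> takes \<omega> C c)"
    define a2 where "a2 = \<P>(\<omega> in ?J. (\<omega> X = x \<and> \<omega> Y \<noteq> y) \<and> takes \<omega> D d \<and> takes \<omega> C c)"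
    define u where "u = \<P>(\<omega> in ?J1. (\<omega> X = x \<and> \<omega> Y = y) \<and> takes \<omega> C c)"
    define w where "w = \<P>(\<omega> in ?J1. (\<omega> X = x \<and> \<omega> Y \<noteq> y) \<and> takes \<omega> C c)"
    have uw: "\<P>(\<omega> in ?J1. \<omega> X = x \<and> takes \<omega> C c) = u + w"
      unfolding u_def w_def
      by (subst q.finite_measure_Union[symmetric]) (auto intro!: arg_cong[of _ _ q.prob])
    have a12: "\<P>(\<omega> in ?J. (\<omega> X = x \<and> takes \<omega> D d) \<and> takes \<omega> C c) = a1 + a2"
      unfolding a1_def a2_def
      by (subst p.finite_measure_Union[symmetric]) (auto intro!: arg_cong[of _ _ p.prob])
    have pc: "pc > 0" using pos unfolding P[OF okC] pc_def .
    have e: "0 \<le> e" unfolding e_def pc_def by (auto intro!: p.finite_measure_mono)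
    have "\<P>(\<omega> in P. \<omega> X = x \<and> takes \<omega> D d \<bar> takes \<omega> C c) = (a1 + a2) / pc"
      unfolding cond_prob_def a12[symmetric] pc_def
      by (intro arg_cong2[of _ _ _ _ "(/)"] P oks)
    moreover have pd: "\<P>(\<omega> in P. takes \<omega> D d \<bar> takes \<omega> C c) = (pc - e) / pc"
      unfolding cond_prob_def e_def diff_diff_eq2 pc_def
      by (simp, intro arg_cong2[of _ _ _ _ "(/)"] P oks)
    ultimately have bd: "bound_denom P X C D x d c = (a1 + a2 + e) / pc"
      unfolding bound_denom_def using pc by (simp add: field_simps)
    have n: "\<P>(\<omega> in P. \<omega> X = x \<and> \<omega> Y = y \<and> takes \<omega> D d \<bar> takes \<omega> C c) = a1 / pc"
    proof -
      have "\<P>(\<omega> in P. (\<omega> X = x \<and> \<omega> Y = y \<and> takes \<omega> D d) \<and> takes \<omega> C c) =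
          \<P>(\<omega> in ?J. (\<omega> X = x \<and> \<omega> Y = y \<and> takes \<omega> D d) \<and> takes \<omega> C c)"
        by (intro P oks)
      then show ?thesis unfolding cond_prob_def P[OF okC] a1_def pc_def by (simp add: conj_ac)
    qed
    have nonneg: "0 \<le> a1" "0 \<le> a2" by (auto simp: a1_def a2_def)
    \<comment> \<open>The denominator is a sum of nonnegative terms, so being nonzero makes it
      positive.\<close>
    have "a1 + a2 + e > 0" using den nonneg e unfolding bd by (cases "a1 + a2 + e = 0") auto
    moreover have "a1 \<le> u" "u \<le> a1 + e" "a2 \<le> w" "w \<le> a2 + e"
      unfolding a1_def a2_def u_def w_def e_def pc_def by (intro b; measurable)+
    moreover have "rho * (u + w) = u"
      using exch unfolding uw by (simp add: u_def conj_ac)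
    ultimately have r: "a1 / (a1 + a2 + e) \<le> rho" "rho \<le> (a1 + e) / (a1 + a2 + e)"
      using quotient_bounds[of a1 u e a2 w rho] nonneg e rho01 by auto
    have e1: "(a1 / pc) / ((a1 + a2 + e) / pc) = a1 / (a1 + a2 + e)"
      using pc by simp
    moreover have "a1 / pc + 1 - (pc - e) / pc = (a1 + e) / pc"
      using pc by (simp add: field_simps)
    then have e2: "(a1 / pc + 1 - (pc - e) / pc) / ((a1 + a2 + e) / pc) = (a1 + e) / (a1 + a2 + e)"
      using pc by simp
    show "lower_bound P X Y C D x y d c \<le> do_prob Q X Y C D x y d c \<and>
        do_prob Q X Y C D x y d c \<le> upper_bound P X Y C D x y d c"
      unfolding lower_bound_def upper_bound_def n pd bd e1 e2 rho_def[symmetric] using r rho01 by simp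
  next
    assume X_not_desc: "\<forall>w\<in>D. \<not> descendant E X w" and pos: "\<P>(\<omega> in P. \<omega> X = x \<and> takes \<omega> C c) > 0"
    let ?T = "insert X C" and ?t = "c(X := x)"
    have T: "takes \<omega> ?T ?t \<longleftrightarrow> \<omega> X = x \<and> takes \<omega> C c" for \<omega>
      using disjoint(2) by (auto simp: takes_def)
    have anc: "D \<inter> anc E ?T = {}"
      using C_not_desc X_not_desc disjoint(3,6)
      by (auto simp: anc_def descendant_def rtrancl_eq_or_trancl)
    have sT: "?T \<subseteq> V" using sub by auto
    have discT: "\<And>v. v \<in> ?T \<Longrightarrow> M v = count_space (space (M v))" using disc observable by auto
    note b = do_law_event_bounds[OF sub(2) Dd sT discT anc, of _ ?t, unfolded T]
    have okT: "ok (\<lambda>\<omega>. \<omega> X = x \<and> takes \<omega> C c)"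
      and ok2: "ok (\<lambda>\<omega>. takes \<omega> D d \<and> \<omega> X = x \<and> takes \<omega> C c)"
      and ok3: "ok (\<lambda>\<omega>. (\<omega> Y = y \<and> takes \<omega> D d) \<and> \<omega> X = x \<and> takes \<omega> C c)"
      by (intro oks)+
    define s where "s = \<P>(\<omega> in ?J. \<omega> X = x \<and> takes \<omega> C c)"
    have s: "s > 0" using pos unfolding P[OF okT] s_def .
    have "\<P>(\<omega> in ?J1. \<omega> X = x \<and> takes \<omega> C c) = s"
      using emeasure_do_law_nondescendants[OF sub(2) Dd sT discT anc, of ?t]
      unfolding T s_def by (simp add: measure_def space_joint_law space_do_law)
    \<comment> \<open>With \<open>q(x, c) = s\<close>, the exchange identity says that
      \<open>rho * s\<close> is a probability under \<open>do(d)\<close>; the event bounds divided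
      by \<open>s\<close> are the claim.\<close>
    then have rs: "rho * s = \<P>(\<omega> in ?J1. \<omega> Y = y \<and> \<omega> X = x \<and> takes \<omega> C c)"
      using exch by (simp add: conj_ac)
    have "lower_bound' P X Y C D x y d c = \<P>(\<omega> in ?J. \<omega> Y = y \<and> takes \<omega> D d \<and> \<omega> X = x \<and> takes \<omega> C c) / s"
      unfolding lower_bound'_def cond_prob_def P[OF okT] P[OF ok3] s_def by simp
    moreover have "\<dots> \<le> rho"
      using b(1)[OF _ _ _ pY[of y]] s unfolding rs[symmetric] by (simp add: divide_le_eq)
    moreover have "upper_bound' P X Y C D x y d c =
        (\<P>(\<omega> in ?J. \<omega> Y = y \<and> takes \<omega> D d \<and> \<omega> X = x \<and> takes \<omega> C c)
          + (s - \<P>(\<omega> in ?J. takes \<omega> D d \<and> \<omega> X = x \<and> takes \<omega> C c))) / s"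
      unfolding upper_bound'_def cond_prob_def P[OF okT] P[OF ok2] P[OF ok3] s_def[symmetric]
      using s by (simp add: field_simps)
    moreover have "rho \<le> \<dots>"
      using b(2)[OF _ _ _ pY[of y]] s unfolding rs[symmetric] s_def[symmetric] by (simp add: le_divide_eq)
    ultimately show "lower_bound' P X Y C D x y d c \<le> do_prob Q X Y C D x y d c \<and>
        do_prob Q X Y C D x y d c \<le> upper_bound' P X Y C D x y d c"
      unfolding rho_def[symmetric] by simp
  }
qed

theorem theorem4p6:
  fixes V H C D :: "'v set" and E :: "('v \<times> 'v) set" and X Y :: 'v
    and M :: "'v \<Rightarrow> 'a measure"
    and f :: "'v \<Rightarrow> ('v \<Rightarrow> 'a) \<Rightarrow> 'a \<Rightarrow> ennreal"
    and P :: "('v \<Rightarrow> 'a) measure"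
    and Q :: "'v set \<Rightarrow> ('v \<Rightarrow> 'a) \<Rightarrow> ('v \<Rightarrow> 'a) measure"
  assumes dag: "finite_dag V E"
    and latent: "H \<subseteq> V" "\<forall>h\<in>H. parents E h = {}"
    and observable: "X \<in> V - H" "Y \<in> V - H" "C \<subseteq> V - H" "D \<subseteq> V - H"
    and disjoint: "X \<noteq> Y" "X \<notin> C" "X \<notin> D" "Y \<notin> C" "Y \<notin> D" "C \<inter> D = {}"
    and edge: "(X, Y) \<in> E"
    and C_not_desc: "\<forall>v\<in>C. \<forall>w\<in>D. \<not> descendant E v w"
    and e_sep: "e_separated V (E - {(X, Y)}) {X} {Y} C D"
    and spaces: "state_spaces V H M"
    and densities: "conditional_densities V E M f"
    and P: "P = margin M (V - H) (joint_law V E M f)"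
    and Q: "Q = (\<lambda>I a. margin M (V - H) (do_law V E M f I a))"
  shows
    "(\<forall>x\<in>space (M X). \<forall>y\<in>space (M Y). \<forall>c\<in>space (PiM C M). \<forall>d\<in>space (PiM D M).
        \<P>(\<omega> in P. takes \<omega> C c) > 0 \<longrightarrow> do_defined Q X C D x d c \<longrightarrow>
        bound_denom P X C D x d c \<noteq> 0 \<longrightarrow>
        lower_bound P X Y C D x y d c \<le> do_prob Q X Y C D x y d c \<and>
        do_prob Q X Y C D x y d c \<le> upper_bound P X Y C D x y d c)
     \<and>
     (\<forall>x\<^sub>0 x\<^sub>1 y\<^sub>0 y\<^sub>1. \<forall>c\<in>space (PiM C M). \<forall>d\<in>space (PiM D M).
        x\<^sub>0 \<noteq> x\<^sub>1 \<longrightarrow> space (M X) = {x\<^sub>0, x\<^sub>1} \<longrightarrow> y\<^sub>0 \<noteq> y\<^sub>1 \<longrightarrow> space (M Y) = {y\<^sub>0, y\<^sub>1} \<longrightarrow>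
        \<P>(\<omega> in P. takes \<omega> C c) > 0 \<longrightarrow>
        do_defined Q X C D x\<^sub>0 d c \<longrightarrow> do_defined Q X C D x\<^sub>1 d c \<longrightarrow>
        bound_denom P X C D x\<^sub>0 d c \<noteq> 0 \<longrightarrow> bound_denom P X C D x\<^sub>1 d c \<noteq> 0 \<longrightarrow>
        lower_bound P X Y C D x\<^sub>1 y\<^sub>1 d c - upper_bound P X Y C D x\<^sub>0 y\<^sub>1 d c
          \<le> ACDE Q X Y C D x\<^sub>0 x\<^sub>1 y\<^sub>1 d c \<and>
        ACDE Q X Y C D x\<^sub>0 x\<^sub>1 y\<^sub>1 d c
          \<le> upper_bound P X Y C D x\<^sub>1 y\<^sub>1 d c - lower_bound P X Y C D x\<^sub>0 y\<^sub>1 d c)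
     \<and>
     ((\<forall>w\<in>D. \<not> descendant E X w) \<longrightarrow>
       (\<forall>x\<in>space (M X). \<forall>y\<in>space (M Y). \<forall>c\<in>space (PiM C M). \<forall>d\<in>space (PiM D M).
          \<P>(\<omega> in P. \<omega> X = x \<and> takes \<omega> C c) > 0 \<longrightarrow> do_defined Q X C D x d c \<longrightarrow>
          lower_bound' P X Y C D x y d c \<le> do_prob Q X Y C D x y d c \<and>
          do_prob Q X Y C D x y d c \<le> upper_bound' P X Y C D x y d c)
       \<and>
       (\<forall>x\<^sub>0 x\<^sub>1 y\<^sub>0 y\<^sub>1. \<forall>c\<in>space (PiM C M). \<forall>d\<in>space (PiM D M).
          x\<^sub>0 \<noteq> x\<^sub>1 \<longrightarrow> space (M X) = {x\<^sub>0, x\<^sub>1} \<longrightarrow> y\<^sub>0 \<noteq> y\<^sub>1 \<longrightarrow> space (M Y) = {y\<^sub>0, y\<^sub>1} \<longrightarrow>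
          \<P>(\<omega> in P. \<omega> X = x\<^sub>0 \<and> takes \<omega> C c) > 0 \<longrightarrow>
          \<P>(\<omega> in P. \<omega> X = x\<^sub>1 \<and> takes \<omega> C c) > 0 \<longrightarrow>
          do_defined Q X C D x\<^sub>0 d c \<longrightarrow> do_defined Q X C D x\<^sub>1 d c \<longrightarrow>
          lower_bound' P X Y C D x\<^sub>1 y\<^sub>1 d c - upper_bound' P X Y C D x\<^sub>0 y\<^sub>1 d c
            \<le> ACDE Q X Y C D x\<^sub>0 x\<^sub>1 y\<^sub>1 d c \<and>
          ACDE Q X Y C D x\<^sub>0 x\<^sub>1 y\<^sub>1 d c
            \<le> upper_bound' P X Y C D x\<^sub>1 y\<^sub>1 d c - lower_bound' P X Y C D x\<^sub>0 y\<^sub>1 d c))"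
proof -
  \<comment> \<open>The hypotheses leave \<open>M\<close> arbitrary outside \<open>V\<close>,
    whereas \<open>product_sigma_finite\<close> concerns every index. A one-point space is put
    there, which changes no product over a subset of \<open>V\<close>.\<close>
  define M' where "M' v = (if v \<in> V then M v else count_space {undefined})" for v
  have EV: "E \<subseteq> V \<times> V" using dag by (simp add: finite_dag_def)
  have PM: "PiM T M' = PiM T M" if "T \<subseteq> V" for T
    using that by (intro PiM_cong) (auto simp: M'_def)
  have par: "parents E v \<subseteq> V" for v using EV by (auto simp: parents_def)
  interpret dag_model M' V E f
  proof (intro dag_model.intro product_sigma_finite.intro dag_model_axioms.intro)
    show "sigma_finite_measure (M' v)" for v
      using spaces by (cases "v \<in> V")
        (auto simp: M'_def state_spaces_def intro!: sigma_finite_measure_count_space_finite)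
    show "finite_dag V E" by (rule dag)
    show "conditional_densities V E M' f"
      using densities by (simp add: conditional_densities_def PM[OF par]) (simp add: M'_def)
  qed
  have P': "P = margin M' (V - H) (joint_law V E M' f)"
    unfolding P margin_def joint_law_def by (simp add: PM)
  have Q': "Q = (\<lambda>I a. margin M' (V - H) (do_law V E M' f I a))"
    unfolding Q margin_def do_law_def by (simp add: PM)
  have disc: "M' v = count_space (space (M' v))" if "v \<in> V - H" for v
    using spaces that by (auto simp: state_spaces_def M'_def)
  have sub: "C \<subseteq> V" "D \<subseteq> V" using observable by auto
  have CD: "space (PiM C M) = space (PiM C M')" "space (PiM D M) = space (PiM D M')"
    unfolding PM[OF sub(1)] PM[OF sub(2)] by (rule refl)+
  have MX: "space (M X) = space (M' X)" using observable by (simp add: M'_def)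
  note bounds = do_prob_bounds[of X H Y C D, folded P' Q', OF observable disc disjoint C_not_desc e_sep]
  have b1: "lower_bound P X Y C D x y d c \<le> do_prob Q X Y C D x y d c"
    "do_prob Q X Y C D x y d c \<le> upper_bound P X Y C D x y d c"
    if "x \<in> space (M X)" "c \<in> space (PiM C M)" "d \<in> space (PiM D M)"
      "\<P>(\<omega> in P. takes \<omega> C c) > 0" "do_defined Q X C D x d c" "bound_denom P X C D x d c \<noteq> 0"
    for x y c d
    using bounds(1)[of x c d y] that unfolding CD MX by auto
  have b2: "lower_bound' P X Y C D x y d c \<le> do_prob Q X Y C D x y d c"
    "do_prob Q X Y C D x y d c \<le> upper_bound' P X Y C D x y d c"
    if "\<forall>w\<in>D. \<not> descendant E X w" "x \<in> space (M X)" "c \<in> space (PiM C M)" "d \<in> space (PiM D M)"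
      "\<P>(\<omega> in P. \<omega> X = x \<and> takes \<omega> C c) > 0" "do_defined Q X C D x d c"
    for x y c d
    using bounds(2)[of x c d y] that unfolding CD MX by auto
  show ?thesis
    \<comment> \<open>The bounds on the direct effect come from \<open>diff_mono\<close>: a lower
      bound at one value of \<open>X\<close> minus an upper bound at the other, and vice
      versa.\<close>
    unfolding ACDE_def by (intro conjI allI ballI impI diff_mono b1 b2) auto
qed

end
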